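(* Let $s\in(0,1)$ and $p\ge 3$. Let $\lambda\in\mathbb{R}$, $\Sigma=\Sigma_\lambda=\{x\in\mathbb{R}^n : x_1>\lambda\}$, and for $x\in\mathbb{R}^n$ let $x^\lambda=(2\lambda-x_1,x_2,\dots,x_n)$. Let $u\in C^3_{loc}(\overline{\Sigma})\cap L_{sp}$, put $u_\lambda(x)=u(x^\lambda)$ and $w(x)=u_\lambda(x)-u(x)$, and let $c$ be a function on $\Sigma$. Assume that $$ \begin{cases} (-\Delta)^s_p u_\lambda(x)-(-\Delta)^s_p u(x)+c(x)w(x)=0, & x\in\Sigma,\\ w(x)>0, & x\in\Sigma,\\ w(x^\lambda)=-w(x), & x\in\Sigma. \end{cases} $$ Let $\nu$ be the outward normal vector on $\partial\Sigma$. If $$c(x)=o\!\left(\frac{1}{[\mathrm{dist}(x,\partial\Sigma)]^2}\right)\quad\text{as } x\to\partial\Sigma,$$ then $$\frac{\partial w}{\partial\nu}(x)<0,\qquad x\in\partial\Sigma.$$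
   Context: For $s\in(0,1)$ and $p>1$ the fractional $p$-Laplacian is $$(-\Delta)^s_p u(x)=C_{n,s,p}\lim_{\varepsilon\to0}\int_{\mathbb{R}^n\setminus B_\varepsilon(x)}\frac{|u(x)-u(y)|^{p-2}(u(x)-u(y))}{|x-y|^{n+ps}}\,dy ,$$ i.e. a Cauchy principal value integral over $\mathbb{R}^n$, where $C_{n,s,p}>0$ is a constant depending only on $n,s,p$. The space $L_{sp}$ is $$L_{sp}=\Big\{u\in L^1_{loc}(\mathbb{R}^n) : \int_{\mathbb{R}^n}\frac{|u(x)|^{p-1}}{1+|x|^{n+sp}}\,dx<\infty\Big\}.$$ To ensure that the principal value is well defined at points of an open set, functions are taken to be $C^{1,1}_{loc}$ there and to belong to $L_{sp}$. Since $\Sigma$ is the half-space $\{x_1>\lambda\}$, the outward normal on $\partial\Sigma$ is $\nu=(-1,0,\dots,0)$. The condition on $c$ means $c(x)[\mathrm{dist}(x,\partial\Sigma)]^2\to0$ as $\mathrm{dist}(x,\partial\Sigma)\to0$.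
   Formalization: "u in C^3_loc(closure of Σ)" is taken to mean that u is C^3 on an open neighbourhood of the closure of Σ, hence across ∂Σ; with C^3 regularity only up to ∂Σ from inside Σ the claim fails (e.g. u=0 on Σ, u=x²/(1+x²) for x<0, n=1, λ=0). *)

theory Defs
  imports "HOL-Analysis.Analysis"
begin

definition plap_integrand ::
    "real \<Rightarrow> real \<Rightarrow> (real ^ 'n \<Rightarrow> real) \<Rightarrow> real ^ 'n \<Rightarrow> real ^ 'n \<Rightarrow> real" where
  "plap_integrand s p u x y =
     \<bar>u x - u y\<bar> powr (p - 2) * (u x - u y) / norm (x - y) powr (real CARD('n) + p * s)"

(* "The fractional p-Laplacian of u at x, with normalising constant C, exists and equals v".
   A relation rather than a function, because the Bochner integral and Lim
   are total: an equation involving the operator must include the existence of the integrals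
   and of their limit. *)
definition has_frac_p_laplacian ::
    "real \<Rightarrow> real \<Rightarrow> real \<Rightarrow> (real ^ 'n \<Rightarrow> real) \<Rightarrow> real ^ 'n \<Rightarrow> real \<Rightarrow> bool" where
  "has_frac_p_laplacian C s p u x v \<longleftrightarrow>
     (\<forall>\<epsilon>>0. set_integrable lebesgue (- ball x \<epsilon>) (plap_integrand s p u x)) \<and>
     ((\<lambda>\<epsilon>. C * (LINT y:- ball x \<epsilon>|lebesgue. plap_integrand s p u x y)) \<longlongrightarrow> v) (at_right 0)"

definition L1_loc :: "(real ^ 'n \<Rightarrow> real) set" where
  "L1_loc = {u. \<forall>K. compact K \<longrightarrow> set_integrable lebesgue K u}"

definition L_sp :: "real \<Rightarrow> real \<Rightarrow> (real ^ 'n \<Rightarrow> real) set" where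
  "L_sp s p = {u \<in> L1_loc.
     integrable lebesgue
       (\<lambda>x. \<bar>u x\<bar> powr (p - 1) / (1 + norm x powr (real CARD('n) + s * p)))}"

(* Used for open U only; the components of the gradient are the first partial derivatives. *)
fun Ck_on :: "nat \<Rightarrow> (real ^ 'n \<Rightarrow> real) \<Rightarrow> (real ^ 'n) set \<Rightarrow> bool" where
  "Ck_on 0 f U \<longleftrightarrow> continuous_on U f"
| "Ck_on (Suc k) f U \<longleftrightarrow>
     (\<exists>g :: real ^ 'n \<Rightarrow> real ^ 'n.
        (\<forall>x\<in>U. GDERIV f x :> g x) \<and> (\<forall>i. Ck_on k (\<lambda>x. g x $ i) U))"

(* C^k_loc(S) for a not necessarily open set S: C^k in a neighbourhood of every point of S.
   For a closed half-space this means C^k across the boundary, not merely up to it, so that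
   the difference of u and its reflection is C^k near the boundary hyperplane and has a
   normal derivative there. *)
definition Ck_loc :: "nat \<Rightarrow> (real ^ 'n) set \<Rightarrow> (real ^ 'n \<Rightarrow> real) set" where
  "Ck_loc k S = {u. \<exists>U. open U \<and> S \<subseteq> U \<and> Ck_on k u U}"

(* The index e selects the coordinate called x_1; it is arbitrary because the
   index type carries no order. *)
definition half_space :: "'n \<Rightarrow> real \<Rightarrow> (real ^ 'n) set" where
  "half_space e l = {x. x $ e > l}"

definition reflect :: "'n \<Rightarrow> real \<Rightarrow> real ^ 'n \<Rightarrow> real ^ 'n" where
  "reflect e l x = (\<chi> i. if i = e then 2 * l - x $ i else x $ i)"

definition approach_boundary :: "(real ^ 'n) set \<Rightarrow> (real ^ 'n) filter" where
  "approach_boundary S =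
     inf (filtercomap (\<lambda>x. infdist x (frontier S)) (nhds 0)) (principal S)"

end

theory Submission
  imports Defs
begin

text \<open>
  The normal derivative of \<open>w\<close> exists and is nonpositive, since \<open>w\<close> is positive in the half-space
  and vanishes on its boundary; what has to be excluded is that it is zero at some boundary point
  \<open>x0\<close>. Suppose it is zero. Along every line through \<open>x0\<close> the function \<open>w\<close> changes sign with the
  coordinate \<open>x $ e - l\<close>, so its second derivative along the line is zero as well
  (\<open>flat_at_contact\<close>), and \<open>w\<close> is of third order at \<open>x0\<close>: with \<open>x = x0 + d e\<close> one has
  \<open>w x \<le> L d^3\<close>. Because \<open>c x = o(1/d^2)\<close>, the equation forces the difference of the two
  fractional Laplacians at \<open>x\<close> to be \<open>o(d)\<close>. The contradiction is that this difference is at most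
  \<open>- c1 d + o(d)\<close> for a positive constant \<open>c1\<close> (\<open>nonlocal_upper_bound\<close>).

  Let \<open>G t = |t|^(p-2) t\<close>, let \<open>K y = |x - y|^(-q)\<close> be the kernel with \<open>q = n + p s\<close>, let \<open>y'\<close> be
  the reflection of \<open>y\<close>, and let \<open>F y = G (ul x - ul y) - G (u x - u y)\<close>, so that the difference of the
  operators is the principal value of the integral of \<open>F K\<close>. The space is cut at radius \<open>d/2\<close>
  around \<open>x\<close>.

  Inside, opposite points \<open>x + z\<close> and \<open>x - z\<close> are paired. First-order terms cancel, and
  since all first and second derivatives of \<open>w\<close> are \<open>O(d)\<close> there, the sum of the two values of \<open>F\<close> is
  \<open>O(d |z|^p)\<close> (\<open>inner_pair_le\<close>); here \<open>p \<ge> 3\<close> is used, which makes the derivative of \<open>G\<close> locally Lipschitz. Since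
  \<open>p - q > - n\<close>, integration gives \<open>o(d)\<close>.

  Outside, \<open>y\<close> in the half-space is paired with \<open>y'\<close>. Write \<open>P b = G (ul x - b) - G (u x - b)\<close>. Then
  \<open>F y + F y' = P (u y) + P (ul y)\<close>, and therefore
  \<open>F y K y + F y' K y' = P (u y) K y + P (ul y) K y' - (P (u y) - F y) (K y - K y')\<close>.
  Each \<open>P\<close> is the increment of \<open>G\<close> over a step of length \<open>w x = O(d^3)\<close>, and the first two
  terms integrate to \<open>o(d)\<close>: the singularity of the kernel costs less than \<open>d^(-2)\<close>, and membership
  in \<open>L_sp\<close> controls infinity. The last product is nonnegative, because \<open>w y \<ge> 0\<close> and \<open>y\<close> is closer
  to \<open>x\<close> than \<open>y'\<close> is. On a fixed ball inside the half-space, \<open>P (u y) - F y\<close> is bounded below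
  because \<open>w\<close> is, and \<open>K y - K y'\<close> is at least a multiple of \<open>d\<close> (\<open>kernel_gap\<close>). That ball
  supplies the term \<open>- c1 d\<close>.
\<close>

section \<open>The power nonlinearity\<close>

definition ppow :: "real \<Rightarrow> real \<Rightarrow> real" where
  "ppow p t = \<bar>t\<bar> powr (p - 2) * t"

lemma ppow_minus [simp]: "ppow p (- t) = - ppow p t"
  by (simp add: ppow_def)

lemma ppow_nonneg_eq: "t \<ge> 0 \<Longrightarrow> ppow p t = t powr (p - 1)"
  by (cases "t = 0") (auto simp: ppow_def powr_mult_base[of t "p - 2"] mult.commute)

lemma ppow_has_derivative:
  assumes "p > 2"
  shows "(ppow p has_real_derivative (p - 1) * \<bar>t\<bar> powr (p - 2)) (at t)"
proof -
  consider "t > 0" | "t < 0" | "t = 0" by linarith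
  then show ?thesis
  proof cases
    case 1
    have "((\<lambda>t. t powr (p - 1)) has_real_derivative (p - 1) * t powr (p - 2)) (at t)"
      using 1 by (auto intro!: derivative_eq_intros simp: field_simps powr_mult_base)
    moreover have "\<forall>\<^sub>F u in nhds t. ppow p u = u powr (p - 1)"
      using eventually_nhds_in_open[of "{0<..}" t] 1
      by (auto elim!: eventually_mono simp: ppow_nonneg_eq)
    ultimately show ?thesis
      using 1 by (simp add: DERIV_cong_ev)
  next
    case 2
    have "((\<lambda>t. - ((- t) powr (p - 1))) has_real_derivative (p - 1) * (- t) powr (p - 2)) (at t)"
      using 2 by (auto intro!: derivative_eq_intros simp: field_simps powr_mult_base)
    moreover have "\<forall>\<^sub>F u in nhds t. ppow p u = - ((- u) powr (p - 1))"
    proof -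
      have "ppow p u = - ((- u) powr (p - 1))" if "u < 0" for u
        using that ppow_minus[of p "-u"] ppow_nonneg_eq[of "-u" p] by simp
      then show ?thesis
        using eventually_nhds_in_open[of "{..<0}" t] 2 by (auto elim!: eventually_mono)
    qed
    ultimately show ?thesis
      using 2 by (simp add: DERIV_cong_ev)
  next
    case 3
    have "((\<lambda>h::real. \<bar>h\<bar> powr (p - 2)) \<longlongrightarrow> \<bar>0\<bar> powr (p - 2)) (at 0)"
      using assms by (intro tendsto_powr2 tendsto_intros) auto
    then have "((\<lambda>h::real. \<bar>h\<bar> powr (p - 2)) \<longlongrightarrow> 0) (at 0)" by simp
    then have "((\<lambda>h. (ppow p (0 + h) - ppow p 0) / h) \<longlongrightarrow> 0) (at 0)"
      by (rule Lim_transform_eventually) (auto simp: ppow_def eventually_at_filter)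
    then show ?thesis using 3 by (simp add: DERIV_def)
  qed
qed

lemma ppow_mono:
  assumes "p > 2" "a \<le> b" shows "ppow p a \<le> ppow p b"
  by (rule DERIV_nonneg_imp_nondecreasing[OF assms(2)])
     (use ppow_has_derivative[OF assms(1)] assms in \<open>auto intro!: exI mult_nonneg_nonneg\<close>)

lemma ppow_diff_le:
  assumes p: "p > 2" and ab: "a \<le> b" "\<bar>a\<bar> \<le> M" "\<bar>b\<bar> \<le> M"
  shows "ppow p b - ppow p a \<le> (p - 1) * M powr (p - 2) * (b - a)"
proof (cases "a = b")
  case False
  then obtain z where z: "a < z" "z < b"
    "ppow p b - ppow p a = (b - a) * ((p - 1) * \<bar>z\<bar> powr (p - 2))"
    using MVT2[of a b "ppow p" "\<lambda>t. (p - 1) * \<bar>t\<bar> powr (p - 2)"] ab ppow_has_derivative[OF p]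
    by (auto simp: less_le)
  have "\<bar>z\<bar> powr (p - 2) \<le> M powr (p - 2)"
    using z ab p by (intro powr_mono2) auto
  then have "(b - a) * ((p - 1) * \<bar>z\<bar> powr (p - 2)) \<le> (b - a) * ((p - 1) * M powr (p - 2))"
    using ab p by (intro mult_left_mono) auto
  then show ?thesis using z by (simp add: ac_simps)
qed simp

lemma ppow_abs_diff_le:
  assumes "p > 2" "\<bar>a\<bar> \<le> M" "\<bar>b\<bar> \<le> M"
  shows "\<bar>ppow p b - ppow p a\<bar> \<le> (p - 1) * M powr (p - 2) * \<bar>b - a\<bar>"
  using ppow_diff_le[of p a b M] ppow_diff_le[of p b a M] ppow_mono[of p a b] ppow_mono[of p b a] assms
  by (cases "a \<le> b") auto

lemma abs_powr_lipschitz: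
  fixes a b M k :: real
  assumes k: "k \<ge> 1" and ab: "\<bar>a\<bar> \<le> M" "\<bar>b\<bar> \<le> M"
  shows "\<bar>\<bar>b\<bar> powr k - \<bar>a\<bar> powr k\<bar> \<le> k * M powr (k - 1) * \<bar>b - a\<bar>"
proof -
  have *: "\<bar>y powr k - x powr k\<bar> \<le> k * M powr (k - 1) * \<bar>y - x\<bar>"
    if xy: "0 \<le> x" "x \<le> y" "y \<le> M" for x y :: real
  proof (cases "x = y")
    case False
    have "continuous_on {x..y} (\<lambda>t. t powr k)"
      using xy k by (intro continuous_on_powr') (auto intro!: continuous_intros)
    moreover have "((\<lambda>t. t powr k) has_real_derivative k * z powr (k - 1)) (at z)" if "x < z" for z
      using that xy by (auto intro!: derivative_eq_intros)
    ultimately obtain l z where z: "x < z" "z < y" "y powr k - x powr k = (y - x) * l"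
      "((\<lambda>t. t powr k) has_real_derivative l) (at z)"
      using MVT[of x y "\<lambda>t. t powr k"] False xy
      by (metis less_le real_differentiable_def)
    then have l: "l = k * z powr (k - 1)"
      using xy by (intro DERIV_unique[OF z(4)]) (auto intro!: derivative_eq_intros)
    have "z powr (k - 1) \<le> M powr (k - 1)"
      using z xy k by (intro powr_mono2) auto
    then have "(y - x) * (k * z powr (k - 1)) \<le> (y - x) * (k * M powr (k - 1))"
      using xy k by (intro mult_left_mono) auto
    moreover have "0 \<le> (y - x) * (k * z powr (k - 1))" using xy k by auto
    ultimately show ?thesis using z xy l by (simp add: ac_simps)
  qed simp
  have "\<bar>\<bar>b\<bar> powr k - \<bar>a\<bar> powr k\<bar> \<le> k * M powr (k - 1) * \<bar>\<bar>b\<bar> - \<bar>a\<bar>\<bar>"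
    using *[of "\<bar>a\<bar>" "\<bar>b\<bar>"] *[of "\<bar>b\<bar>" "\<bar>a\<bar>"] ab
    by (cases "\<bar>a\<bar> \<le> \<bar>b\<bar>") (auto simp: abs_minus_commute)
  also have "\<dots> \<le> k * M powr (k - 1) * \<bar>b - a\<bar>"
    using k by (intro mult_left_mono) auto
  finally show ?thesis .
qed

text \<open>
  For \<open>p \<ge> 3\<close> the derivative of \<open>ppow p\<close> is Lipschitz on bounded sets, so the increment
  of \<open>ppow p\<close> over a step \<open>b\<close>, as a function of the starting point, has Lipschitz constant of order
  \<open>\<bar>b\<bar>\<close>.
\<close>
lemma ppow_second_diff_le:
  assumes p: "p \<ge> 3" and M: "\<bar>a\<bar> \<le> M" "\<bar>a'\<bar> \<le> M" "\<bar>a + b\<bar> \<le> M" "\<bar>a' + b\<bar> \<le> M"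
  shows "\<bar>(ppow p (a + b) - ppow p a) - (ppow p (a' + b) - ppow p a')\<bar>
           \<le> (p - 1) * (p - 2) * M powr (p - 3) * \<bar>b\<bar> * \<bar>a - a'\<bar>"
proof -
  have *: "\<bar>(ppow p (y + b) - ppow p y) - (ppow p (x + b) - ppow p x)\<bar>
           \<le> (p - 1) * (p - 2) * M powr (p - 3) * \<bar>b\<bar> * (y - x)"
    if xy: "x < y" and M': "\<bar>x\<bar> \<le> M" "\<bar>y\<bar> \<le> M" "\<bar>x + b\<bar> \<le> M" "\<bar>y + b\<bar> \<le> M" for x y
  proof -
    have "((\<lambda>t. ppow p (t + b) - ppow p t) has_real_derivative
       (p - 1) * \<bar>t + b\<bar> powr (p - 2) - (p - 1) * \<bar>t\<bar> powr (p - 2)) (at t)" for t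
      using p by (intro DERIV_diff DERIV_shift[THEN iffD1] ppow_has_derivative) auto
    then obtain z where z: "x < z" "z < y"
       "(ppow p (y + b) - ppow p y) - (ppow p (x + b) - ppow p x)
        = (y - x) * ((p - 1) * \<bar>z + b\<bar> powr (p - 2) - (p - 1) * \<bar>z\<bar> powr (p - 2))"
      using MVT2[OF xy, of "\<lambda>t. ppow p (t + b) - ppow p t"
        "\<lambda>t. (p - 1) * \<bar>t + b\<bar> powr (p - 2) - (p - 1) * \<bar>t\<bar> powr (p - 2)"] by auto
    have "\<bar>\<bar>z + b\<bar> powr (p - 2) - \<bar>z\<bar> powr (p - 2)\<bar> \<le> (p - 2) * M powr (p - 3) * \<bar>b\<bar>"
      using abs_powr_lipschitz[of "p - 2" z M "z + b"] M' z p by auto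
    then have "(y - x) * ((p - 1) * \<bar>\<bar>z + b\<bar> powr (p - 2) - \<bar>z\<bar> powr (p - 2)\<bar>)
       \<le> (y - x) * ((p - 1) * ((p - 2) * M powr (p - 3) * \<bar>b\<bar>))"
      using xy p by (intro mult_left_mono) auto
    then show ?thesis
      unfolding z(3) abs_mult right_diff_distrib[symmetric] using xy p by (simp add: ac_simps)
  qed
  consider "a < a'" | "a' < a" | "a = a'" by linarith
  then show ?thesis
    by cases (use *[of a a'] *[of a' a] M in \<open>auto simp: abs_minus_commute\<close>)
qed

text \<open>
  A lower bound for the increment that does not depend on the starting point: \<open>ppow p\<close> is flattest
  around 0, so some half of the interval from \<open>a - m\<close> to \<open>a\<close> does at least as well as the interval
  from 0 to \<open>m / 2\<close>.
\<close>
lemma ppow_gap: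
  assumes p: "p > 2" and m: "m > 0"
  shows "ppow p (m / 2) \<le> ppow p a - ppow p (a - m)"
proof -
  have *: "ppow p (m / 2) \<le> ppow p a - ppow p (a - m)" if "a \<ge> m" for a
  proof -
    have "ppow p (a - m) \<le> a powr (p - 2) * (a - m)"
      unfolding ppow_def using that m p by (intro mult_right_mono powr_mono2) auto
    then have "a powr (p - 2) * m \<le> ppow p a - ppow p (a - m)"
      using that m by (simp add: ppow_def algebra_simps)
    moreover have "ppow p (m / 2) \<le> a powr (p - 2) * m"
      unfolding ppow_def using that m p by (intro mult_mono powr_mono2) auto
    ultimately show ?thesis by linarith
  qed
  consider "a \<ge> m" | "m / 2 \<le> a" "a \<le> m" | "0 \<le> a" "a \<le> m / 2" | "a \<le> 0" by linarith
  then show ?thesis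
  proof cases
    case 2
    then show ?thesis using ppow_mono[OF p, of "m/2" a] ppow_mono[OF p, of "a - m" 0]
      by (simp add: ppow_def)
  next
    case 3
    then have "0 \<le> ppow p a" by (simp add: ppow_def)
    moreover have "ppow p (m / 2) \<le> ppow p (m - a)" using 3 by (intro ppow_mono p) auto
    ultimately show ?thesis using ppow_minus[of p "a - m"] by simp
  next
    case 4
    then show ?thesis using *[of "m - a"] ppow_minus[of p "a - m"] ppow_minus[of p a] by simp
  qed (rule *)
qed

section \<open>Reflection-invariant integrals and integrable weights\<close>

text \<open>
  Point reflections and reflections in coordinate hyperplanes are both of the form below, with
  coefficients \<open>\<plusminus> 1\<close>.
\<close>
lemma lebesgue_distr_flip:
  fixes t :: "'a::euclidean_space" and c :: "'a \<Rightarrow> real"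
  assumes c: "\<And>j. j \<in> Basis \<Longrightarrow> \<bar>c j\<bar> = 1"
    and T: "\<And>x. T x = t + (\<Sum>j\<in>Basis. (c j * (x \<bullet> j)) *\<^sub>R j)"
  shows "T \<in> lebesgue \<rightarrow>\<^sub>M lebesgue" and "distr lebesgue lebesgue T = lebesgue"
proof -
  have T': "T = (\<lambda>x. t + (\<Sum>j\<in>Basis. (c j * (x \<bullet> j)) *\<^sub>R j))" using T by auto
  have c0: "\<And>j. j \<in> Basis \<Longrightarrow> c j \<noteq> 0" using c by force
  show "T \<in> lebesgue \<rightarrow>\<^sub>M lebesgue"
    unfolding T' by (rule lebesgue_affine_measurable) (use c0 in auto)
  have "(\<Prod>j\<in>Basis. \<bar>c j\<bar>) = 1" using c by simp
  then show "distr lebesgue lebesgue T = lebesgue"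
    using lebesgue_affine_euclidean[of c t] c0 unfolding T' by (simp add: density_1)
qed

lemma lebesgue_distr_point_reflection:
  fixes x :: "'a::euclidean_space"
  shows "(\<lambda>y. 2 *\<^sub>R x - y) \<in> lebesgue \<rightarrow>\<^sub>M lebesgue"
    and "distr lebesgue lebesgue (\<lambda>y. 2 *\<^sub>R x - y) = lebesgue"
proof -
  have "2 *\<^sub>R x - y = 2 *\<^sub>R x + (\<Sum>j\<in>Basis. (- 1 * (y \<bullet> j)) *\<^sub>R j)" for y
    by (simp add: sum_negf euclidean_representation)
  from lebesgue_distr_flip[of "\<lambda>_. -1", OF _ this]
  show "(\<lambda>y. 2 *\<^sub>R x - y) \<in> lebesgue \<rightarrow>\<^sub>M lebesgue"
    and "distr lebesgue lebesgue (\<lambda>y. 2 *\<^sub>R x - y) = lebesgue" by simp_all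
qed

lemma integral_point_reflection:
  fixes h :: "'a::euclidean_space \<Rightarrow> real"
  assumes "integrable lebesgue h"
  shows "integrable lebesgue (\<lambda>y. h (a - y))"
    and "(LINT y|lebesgue. h (a - y)) = (LINT y|lebesgue. h y)"
proof -
  have "a - y = 2 *\<^sub>R ((1/2) *\<^sub>R a) - y" for y by simp
  note T = lebesgue_distr_point_reflection[of "(1/2) *\<^sub>R a", folded this]
  show "integrable lebesgue (\<lambda>y. h (a - y))" "(LINT y|lebesgue. h (a - y)) = (LINT y|lebesgue. h y)"
    using integrable_distr[of "(-) a" lebesgue lebesgue h] integral_distr[of "(-) a" lebesgue lebesgue h]
      T assms by auto
qed

lemma lebesgue_distr_reflect:
  fixes e :: "'n::finite"
  shows "reflect e l \<in> lebesgue \<rightarrow>\<^sub>M lebesgue"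
    and "distr lebesgue lebesgue (reflect e l) = lebesgue"
proof -
  have "reflect e l y = axis e (2 * l) +
      (\<Sum>j\<in>Basis. ((if j = axis e 1 then - 1 else 1) * (y \<bullet> j)) *\<^sub>R j)" (is "_ = ?R y") for y
  proof (rule euclidean_eqI)
    fix b :: "real ^ 'n" assume "b \<in> Basis"
    then obtain i where b: "b = axis i 1" by (auto simp: Basis_vec_def)
    have "?R y \<bullet> b = axis e (2 * l) \<bullet> b + (if b = axis e 1 then - 1 else 1) * (y \<bullet> b)"
      using \<open>b \<in> Basis\<close> by (simp add: inner_add_left inner_sum_left_Basis)
    also have "\<dots> = (if i = e then 2 * l - y $ i else y $ i)"
      by (cases "i = e") (simp_all add: b inner_axis axis_eq_axis, simp_all add: axis_def)
    also have "\<dots> = reflect e l y \<bullet> b"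
      by (simp add: b inner_axis reflect_def)
    finally show "reflect e l y \<bullet> b = ?R y \<bullet> b" ..
  qed
  from lebesgue_distr_flip[OF _ this]
  show "reflect e l \<in> lebesgue \<rightarrow>\<^sub>M lebesgue"
    and "distr lebesgue lebesgue (reflect e l) = lebesgue" by simp_all
qed

text \<open>
  If \<open>T\<close> preserves the measure, the integral of \<open>f\<close> is half that of \<open>f + f \<circ> T\<close>; integrals can thus be
  compared after pairing \<open>y\<close> with \<open>T y\<close>, which is how all cancellations below are used.
\<close>
lemma integral_mono_symmetrized:
  fixes f g :: "'a::euclidean_space \<Rightarrow> real"
  assumes T: "T \<in> lebesgue \<rightarrow>\<^sub>M lebesgue" "distr lebesgue lebesgue T = lebesgue"
    and f: "integrable lebesgue f" and g: "integrable lebesgue g"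
    and le: "\<And>y. f y + f (T y) \<le> g y + g (T y)"
  shows "(LINT y|lebesgue. f y) \<le> (LINT y|lebesgue. g y)"
proof -
  have inv: "integrable lebesgue (\<lambda>y. h (T y)) \<and>
      (LINT y|lebesgue. h (T y)) = (LINT y|lebesgue. h y)"
    if "integrable lebesgue h" for h :: "'a \<Rightarrow> real"
    using integrable_distr[of T lebesgue lebesgue h] integral_distr[of T lebesgue lebesgue h] T that
    by auto
  have "(LINT y|lebesgue. f y + f (T y)) \<le> (LINT y|lebesgue. g y + g (T y))"
    using inv[OF f] inv[OF g] f g le by (intro integral_mono) auto
  then show ?thesis using inv[OF f] inv[OF g] f g by simp
qed

text \<open>
  The function is dominated by \<open>\<Sum>k. a k * indicator (ball 0 (\<rho> k))\<close>, whose integral is a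
  multiple of the given series. With \<open>\<rho> k = 2^(-k)\<close> or \<open>\<rho> k = 2^k\<close> this is dyadic
  decomposition near the origin or at infinity.
\<close>
lemma integrable_if_ball_cover:
  fixes f :: "'a::euclidean_space \<Rightarrow> real" and \<rho> a :: "nat \<Rightarrow> real"
  assumes f: "f \<in> borel_measurable lebesgue" "\<And>y. 0 \<le> f y"
    and \<rho>: "\<And>k. 0 \<le> \<rho> k" and a: "\<And>k. 0 \<le> a k"
    and sum: "summable (\<lambda>k. a k * \<rho> k ^ DIM('a))"
    and cover: "\<And>y. f y \<noteq> 0 \<Longrightarrow> \<exists>k. norm y < \<rho> k \<and> f y \<le> a k"
  shows "integrable lebesgue f"
proof (rule integrableI_nonneg)
  have le: "ennreal (f y) \<le> (\<Sum>k. ennreal (a k) * indicator (ball 0 (\<rho> k)) y)" for y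
  proof (cases "f y = 0")
    case False
    then obtain k where "norm y < \<rho> k" "f y \<le> a k" using cover by blast
    then have "ennreal (f y) \<le> ennreal (a k) * indicator (ball 0 (\<rho> k)) y"
      by (simp add: ennreal_leI)
    also have "\<dots> = (\<Sum>k\<in>{k}. ennreal (a k) * indicator (ball 0 (\<rho> k)) y)"
      by (simp only: sum.insert finite.emptyI sum.empty empty_iff not_False_eq_True add_0_right)
    also have "\<dots> \<le> (\<Sum>k. ennreal (a k) * indicator (ball 0 (\<rho> k)) y)"
      by (rule sum_le_suminf) auto
    finally show ?thesis .
  qed simp
  have "(\<integral>\<^sup>+y. ennreal (f y) \<partial>lebesgue)
      \<le> (\<integral>\<^sup>+y. (\<Sum>k. ennreal (a k) * indicator (ball 0 (\<rho> k)) y) \<partial>(lebesgue::'a measure))"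
    by (rule nn_integral_mono) (rule le)
  also have "\<dots> = (\<Sum>k. \<integral>\<^sup>+y. ennreal (a k) * indicator (ball 0 (\<rho> k)) y \<partial>(lebesgue::'a measure))"
    by (intro nn_integral_suminf borel_measurable_times_ennreal borel_measurable_const
        borel_measurable_indicator) auto
  also have "\<dots> = (\<Sum>k. ennreal (unit_ball_vol DIM('a) * (a k * \<rho> k ^ DIM('a))))"
  proof (rule suminf_cong)
    fix k
    have "(\<integral>\<^sup>+y. ennreal (a k) * indicator (ball 0 (\<rho> k)) y \<partial>(lebesgue::'a measure))
        = ennreal (a k) * emeasure lebesgue (ball (0::'a) (\<rho> k))"
      by (rule nn_integral_cmult_indicator) auto
    also have "\<dots> = ennreal (unit_ball_vol DIM('a) * (a k * \<rho> k ^ DIM('a)))"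
      using a \<rho> by (simp add: emeasure_ball ennreal_mult' ac_simps)
    finally show "(\<integral>\<^sup>+y. ennreal (a k) * indicator (ball 0 (\<rho> k)) y \<partial>(lebesgue::'a measure)) = \<dots>" .
  qed
  also have "\<dots> = ennreal (\<Sum>k. unit_ball_vol DIM('a) * (a k * \<rho> k ^ DIM('a)))"
    using a \<rho> sum by (intro suminf_ennreal2 summable_mult) auto
  also have "\<dots> < \<infinity>" by simp
  finally show "(\<integral>\<^sup>+y. ennreal (f y) \<partial>lebesgue) < \<infinity>" .
qed (use f in auto)

lemma ex_dyadic_shell:
  fixes t :: real
  assumes "0 < t" "t < 1"
  shows "\<exists>k. (1/2) ^ Suc k \<le> t \<and> t < (1/2) ^ k"
proof -
  obtain m where m: "(1/2) ^ m < t" using real_arch_pow_inv[of t "1/2"] assms by auto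
  define k where "k = (LEAST m. (1/2) ^ m \<le> t)"
  have k: "(1/2) ^ k \<le> t" unfolding k_def by (rule LeastI[of _ m]) (use m in auto)
  have "k \<noteq> 0" using k assms by (intro notI) auto
  then obtain j where j: "k = Suc j" by (cases k) auto
  have "\<not> (1/2) ^ j \<le> t" using not_less_Least[of j "\<lambda>m. (1/2) ^ m \<le> t"] j k_def by auto
  then show ?thesis using k j by (intro exI[of _ j]) auto
qed

lemma integrable_norm_powr_unit_ball:
  fixes \<alpha> :: real
  assumes \<alpha>: "0 < \<alpha>" "\<alpha> \<le> real DIM('a)"
  shows "integrable lebesgue (\<lambda>z::'a::euclidean_space.
           indicator (ball 0 1) z * norm z powr (\<alpha> - real DIM('a)))"
proof (rule integrable_if_ball_cover[where \<rho> = "\<lambda>k. (1/2) ^ k"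
      and a = "\<lambda>k. ((1/2) ^ Suc k) powr (\<alpha> - real DIM('a))"])
  let ?n = "real DIM('a)"
  have "((1/2) ^ Suc k) powr (\<alpha> - ?n) * ((1/2) ^ k) ^ DIM('a)
        = (1/2) powr (\<alpha> - ?n) * ((1/2) powr \<alpha>) ^ k" for k
    unfolding power_mult[symmetric]
    by (simp add: powr_power powr_powr powr_add[symmetric] algebra_simps flip: powr_realpow del: power_Suc)
  moreover have "(1/2) powr \<alpha> < (1::real)" using powr_less_mono'[of "1/2" 0 \<alpha>] \<alpha> by simp
  ultimately show "summable (\<lambda>k. ((1/2) ^ Suc k) powr (\<alpha> - ?n) * ((1/2) ^ k) ^ DIM('a))"
    by (auto intro!: summable_mult summable_geometric)
next
  fix y :: 'a assume "indicator (ball 0 1) y * norm y powr (\<alpha> - real DIM('a)) \<noteq> 0"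
  then have y: "0 < norm y" "norm y < 1" by (auto simp: indicator_def split: if_splits)
  from ex_dyadic_shell[OF this] obtain k where k: "(1/2) ^ Suc k \<le> norm y" "norm y < (1/2) ^ k" by auto
  have "norm y powr (\<alpha> - real DIM('a)) \<le> ((1/2) ^ Suc k) powr (\<alpha> - real DIM('a))"
    using k \<alpha> by (intro powr_mono2') auto
  then show "\<exists>k. norm y < (1 / 2) ^ k \<and> indicator (ball 0 1) y * norm y powr (\<alpha> - real DIM('a))
      \<le> ((1 / 2) ^ Suc k) powr (\<alpha> - real DIM('a))"
    using k y by (intro exI[of _ k]) auto
next
  have "(\<lambda>z::'a. indicator (ball 0 1) z * norm z powr (\<alpha> - real DIM('a))) \<in> borel_measurable lborel"
    by (intro borel_measurable_times borel_measurable_indicator powr_real_measurable) auto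
  then show "(\<lambda>z::'a. indicator (ball 0 1) z * norm z powr (\<alpha> - real DIM('a)))
      \<in> borel_measurable lebesgue"
    by (rule measurable_completion)
qed auto

lemma integrable_inverse_one_plus_norm_powr:
  fixes q :: real
  assumes q: "real DIM('a) < q"
  shows "integrable lebesgue (\<lambda>y::'a::euclidean_space. 1 / (1 + norm y powr q))"
proof (rule integrable_if_ball_cover[where \<rho> = "\<lambda>k. 2 ^ k" and a = "\<lambda>k. 2 powr (q - q * real k)"])
  let ?n = "real DIM('a)"
  have "2 powr (q - q * real k) * (2 ^ k) ^ DIM('a) = 2 powr q * (2 powr (?n - q)) ^ k" for k
    by (simp add: powr_powr powr_add[symmetric] algebra_simps flip: powr_realpow power_mult)
  moreover have "2 powr (?n - q) < 1" using powr_less_mono[of "?n - q" 0 2] q by simp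
  ultimately show "summable (\<lambda>k. 2 powr (q - q * real k) * (2 ^ k) ^ DIM('a))"
    by (auto intro!: summable_mult summable_geometric)
next
  fix y :: 'a
  show "\<exists>k. norm y < 2 ^ k \<and> 1 / (1 + norm y powr q) \<le> 2 powr (q - q * real k)"
  proof (cases "norm y < 1")
    case True
    have "1 \<le> 2 powr q" using q by (intro ge_one_powr_ge_zero) auto
    moreover have "1 / (1 + norm y powr q) \<le> 1"
      by (intro divide_le_eq_1_pos[THEN iffD2]) (auto intro: add_pos_nonneg)
    ultimately show ?thesis using True by (intro exI[of _ 0]) auto
  next
    case False
    then obtain m where m: "norm y < 2 ^ m" using real_arch_pow[of 2] by auto
    define k where "k = (LEAST m. norm y < 2 ^ m)"
    have k: "norm y < 2 ^ k" unfolding k_def by (rule LeastI[of _ m]) (rule m)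
    have "k \<noteq> 0" using k False by (intro notI) auto
    then obtain j where j: "k = Suc j" by (cases k) auto
    have "\<not> norm y < 2 ^ j" using not_less_Least[of j "\<lambda>m. norm y < 2 ^ m"] j k_def by auto
    then have "2 powr real j \<le> norm y" by (simp add: powr_realpow)
    then have "(2 powr real j) powr q \<le> norm y powr q" using q by (intro powr_mono2) auto
    then have "1 / (1 + norm y powr q) \<le> 1 / (2 powr real j) powr q"
      by (intro divide_left_mono mult_pos_pos add_pos_nonneg) auto
    also have "\<dots> = 2 powr (q - q * real k)"
      by (simp add: j powr_powr powr_minus_divide[symmetric] algebra_simps)
    finally show ?thesis using k by (intro exI[of _ k]) auto
  qed
next
  have "(\<lambda>y::'a. 1 / (1 + norm y powr q)) \<in> borel_measurable lborel" by measurable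
  then show "(\<lambda>y::'a. 1 / (1 + norm y powr q)) \<in> borel_measurable lebesgue"
    by (rule measurable_completion)
qed auto

section \<open>Functions with Lipschitz second derivatives\<close>

lemma GDERIV_imp_isCont: "GDERIV f x :> D \<Longrightarrow> isCont f x"
  unfolding gderiv_def by (rule has_derivative_continuous)

lemma GDERIV_along_line:
  assumes "GDERIV f (y + t *\<^sub>R z) :> D"
  shows "((\<lambda>t. f (y + t *\<^sub>R z)) has_real_derivative D \<bullet> z) (at t)"
proof -
  have "((\<lambda>t. y + t *\<^sub>R z) has_derivative (\<lambda>h. h *\<^sub>R z)) (at t)"
    by (auto intro!: derivative_eq_intros)
  from has_derivative_compose[OF this, of f "\<lambda>h. h \<bullet> D"] assms
  have "((\<lambda>t. f (y + t *\<^sub>R z)) has_derivative (\<lambda>h. (h *\<^sub>R z) \<bullet> D)) (at t)"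
    by (simp add: gderiv_def)
  then show ?thesis
    by (simp add: has_field_derivative_def inner_commute mult_commute_abs)
qed

lemma Ck_on_imp_continuous_on: "Ck_on k f U \<Longrightarrow> continuous_on U f"
  by (cases k) (auto intro!: continuous_at_imp_continuous_on dest: GDERIV_imp_isCont)

lemma Ck_on_imp_bounded_lipschitz:
  fixes f :: "real ^ 'n \<Rightarrow> real"
  assumes f: "Ck_on (Suc k) f U" and S: "compact S" "convex S" "S \<subseteq> U"
  shows "\<exists>L. \<forall>y\<in>S. \<bar>f y\<bar> \<le> L \<and> (\<forall>y'\<in>S. \<bar>f y - f y'\<bar> \<le> L * norm (y - y'))"
proof -
  obtain g where g: "\<And>x. x \<in> U \<Longrightarrow> GDERIV f x :> g x" "\<And>i. Ck_on k (\<lambda>x. g x $ i) U"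
    using f by auto
  have "continuous_on S (\<lambda>x. \<chi> i. g x $ i)"
    using g(2) S(3)
    by (intro continuous_on_vec_lambda) (blast intro: continuous_on_subset Ck_on_imp_continuous_on)
  then have "continuous_on S g" by simp
  then have "bounded (g ` S)" using S(1) by (intro compact_imp_bounded compact_continuous_image)
  then obtain L1 where L1: "\<And>y. y \<in> S \<Longrightarrow> norm (g y) \<le> L1" by (auto simp: bounded_iff)
  have "bounded (f ` S)" using S Ck_on_imp_continuous_on[OF f]
    by (intro compact_imp_bounded compact_continuous_image) (auto intro: continuous_on_subset)
  then obtain L2 where L2: "\<And>y. y \<in> S \<Longrightarrow> \<bar>f y\<bar> \<le> L2" by (auto simp: bounded_iff)
  have lip: "\<bar>f y - f y'\<bar> \<le> L1 * norm (y - y')" if "y \<in> S" "y' \<in> S" for y y'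
  proof -
    have "norm (f y - f y') \<le> L1 * norm (y - y')"
    proof (rule differentiable_bound[OF S(2)])
      fix x assume x: "x \<in> S"
      show "(f has_derivative (\<lambda>h. h \<bullet> g x)) (at x within S)"
        using g(1)[of x] x S(3) by (auto simp: gderiv_def intro: has_derivative_at_withinI)
      show "onorm (\<lambda>h. h \<bullet> g x) \<le> L1"
      proof (rule onorm_le)
        fix h
        show "norm (h \<bullet> g x) \<le> L1 * norm h"
          using Cauchy_Schwarz_ineq2[of h "g x"] mult_left_mono[OF L1[OF x], of "norm h"]
          by (simp add: mult.commute)
      qed
    qed (use that in auto)
    then show ?thesis by simp
  qed
  show ?thesis
  proof (intro exI[of _ "max L1 L2"] ballI conjI)
    fix y y' assume "y \<in> S" "y' \<in> S"
    then have "\<bar>f y - f y'\<bar> \<le> L1 * norm (y - y')" by (rule lip)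
    also have "\<dots> \<le> max L1 L2 * norm (y - y')" by (intro mult_right_mono) auto
    finally show "\<bar>f y - f y'\<bar> \<le> max L1 L2 * norm (y - y')" .
  qed (use L2 in \<open>force simp: le_max_iff_disj\<close>)
qed

lemma Ck_on_components_imp_bounded_lipschitz:
  fixes g :: "real ^ 'n \<Rightarrow> real ^ 'm"
  assumes g: "\<And>i. Ck_on (Suc k) (\<lambda>x. g x $ i) U" and S: "compact S" "convex S" "S \<subseteq> U"
  shows "\<exists>L\<ge>0. \<forall>y\<in>S. norm (g y) \<le> L \<and> (\<forall>y'\<in>S. norm (g y - g y') \<le> L * norm (y - y'))"
proof -
  have "\<exists>L. \<forall>i. \<forall>y\<in>S. \<bar>g y $ i\<bar> \<le> L i \<and> (\<forall>y'\<in>S. \<bar>g y $ i - g y' $ i\<bar> \<le> L i * norm (y - y'))"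
    using Ck_on_imp_bounded_lipschitz[OF g S] by (intro choice) auto
  then obtain L where L: "\<And>i y. y \<in> S \<Longrightarrow> \<bar>g y $ i\<bar> \<le> L i"
    "\<And>i y y'. y \<in> S \<Longrightarrow> y' \<in> S \<Longrightarrow> \<bar>g y $ i - g y' $ i\<bar> \<le> L i * norm (y - y')" by blast
  show ?thesis
  proof (intro exI[of _ "\<bar>\<Sum>i\<in>UNIV. L i\<bar>"] conjI ballI)
    fix y assume y: "y \<in> S"
    have "norm (g y) \<le> (\<Sum>i\<in>UNIV. \<bar>g y $ i\<bar>)" by (rule norm_le_l1_cart)
    also have "\<dots> \<le> (\<Sum>i\<in>UNIV. L i)" using L(1) y by (intro sum_mono) auto
    finally show "norm (g y) \<le> \<bar>\<Sum>i\<in>UNIV. L i\<bar>" by simp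
    fix y' assume y': "y' \<in> S"
    have "norm (g y - g y') \<le> (\<Sum>i\<in>UNIV. \<bar>(g y - g y') $ i\<bar>)" by (rule norm_le_l1_cart)
    also have "\<dots> \<le> (\<Sum>i\<in>UNIV. L i * norm (y - y'))"
      using L(2) y y' by (intro sum_mono) auto
    also have "\<dots> \<le> \<bar>\<Sum>i\<in>UNIV. L i\<bar> * norm (y - y')"
      unfolding sum_distrib_right[symmetric] by (intro mult_right_mono) auto
    finally show "norm (g y - g y') \<le> \<bar>\<Sum>i\<in>UNIV. L i\<bar> * norm (y - y')" .
  qed auto
qed

text \<open>
  The regularity of \<open>u\<close> and \<open>w\<close> that the estimates use: a gradient \<open>g\<close> and a second derivative,
  recorded through its values \<open>Q y z\<close> in direction \<open>z\<close>, all bounded and Lipschitz with a common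
  constant. Values in single directions are all that Taylor expansion along segments asks for.
\<close>
locale hessian_lipschitz =
  fixes S :: "'a::euclidean_space set" and f :: "'a \<Rightarrow> real" and g :: "'a \<Rightarrow> 'a"
    and Q :: "'a \<Rightarrow> 'a \<Rightarrow> real" and L :: real
  assumes convex: "convex S"
    and gradient: "y \<in> S \<Longrightarrow> GDERIV f y :> g y"
    and hessian: "y \<in> S \<Longrightarrow> ((\<lambda>t. g (y + t *\<^sub>R z) \<bullet> z) has_real_derivative Q y z) (at 0)"
    and L_nonneg: "0 \<le> L"
    and gradient_bound: "y \<in> S \<Longrightarrow> norm (g y) \<le> L"
    and gradient_lipschitz: "y \<in> S \<Longrightarrow> y' \<in> S \<Longrightarrow> norm (g y - g y') \<le> L * norm (y - y')"
    and hessian_bound: "y \<in> S \<Longrightarrow> \<bar>Q y z\<bar> \<le> L * norm z ^ 2"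
    and hessian_lip: "y \<in> S \<Longrightarrow> y' \<in> S \<Longrightarrow> \<bar>Q y z - Q y' z\<bar> \<le> L * norm (y - y') * norm z ^ 2"
begin

lemma derivative_along:
  "y + t *\<^sub>R z \<in> S \<Longrightarrow> ((\<lambda>t. f (y + t *\<^sub>R z)) has_real_derivative g (y + t *\<^sub>R z) \<bullet> z) (at t)"
  by (rule GDERIV_along_line[OF gradient])

lemma second_derivative_along:
  assumes "y + t *\<^sub>R z \<in> S"
  shows "((\<lambda>t. g (y + t *\<^sub>R z) \<bullet> z) has_real_derivative Q (y + t *\<^sub>R z) z) (at t)"
proof -
  have "((\<lambda>s. g (y + (s + t) *\<^sub>R z) \<bullet> z) has_real_derivative Q (y + t *\<^sub>R z) z) (at 0)"
    using hessian[OF assms, of z] by (simp add: algebra_simps)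
  then show ?thesis using DERIV_shift[of "\<lambda>t. g (y + t *\<^sub>R z) \<bullet> z" "Q (y + t *\<^sub>R z) z" 0 t] by simp
qed

lemma segment_subset:
  assumes "y \<in> S" "y + z \<in> S" "0 \<le> t" "t \<le> 1" shows "y + t *\<^sub>R z \<in> S"
proof -
  have "(1 - t) *\<^sub>R y + t *\<^sub>R (y + z) \<in> S" using convex assms by (intro convexD_alt) auto
  then show ?thesis by (simp add: algebra_simps)
qed

lemma mean_value:
  assumes "y \<in> S" "y + z \<in> S"
  obtains t where "0 < t" "t < 1" "f (y + z) - f y = g (y + t *\<^sub>R z) \<bullet> z"
  using MVT2[of 0 1 "\<lambda>t. f (y + t *\<^sub>R z)" "\<lambda>t. g (y + t *\<^sub>R z) \<bullet> z"]
    derivative_along segment_subset[OF assms] by (auto simp: that)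

lemma lipschitz:
  assumes "y \<in> S" "y' \<in> S" shows "\<bar>f y - f y'\<bar> \<le> L * norm (y - y')"
proof -
  obtain t where t: "0 < t" "t < 1" "f y - f y' = g (y' + t *\<^sub>R (y - y')) \<bullet> (y - y')"
    using mean_value[of y' "y - y'"] assms by auto
  have "\<bar>g (y' + t *\<^sub>R (y - y')) \<bullet> (y - y')\<bar> \<le> norm (g (y' + t *\<^sub>R (y - y'))) * norm (y - y')"
    by (rule Cauchy_Schwarz_ineq2)
  also have "\<dots> \<le> L * norm (y - y')"
    using t assms by (intro mult_right_mono gradient_bound segment_subset) auto
  finally show ?thesis using t by simp
qed

lemma second_difference_le:
  assumes xz: "x + z \<in> S" "x - z \<in> S"
    and M: "\<And>t. \<bar>t\<bar> \<le> 1 \<Longrightarrow> \<bar>Q (x + t *\<^sub>R z) z\<bar> \<le> M"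
  shows "\<bar>f (x + z) + f (x - z) - 2 * f x\<bar> \<le> 2 * M"
proof -
  have line: "x + t *\<^sub>R z \<in> S" if "\<bar>t\<bar> \<le> 1" for t
  proof -
    have "((t + 1) / 2) *\<^sub>R (2 *\<^sub>R z) = (t + 1) *\<^sub>R z" by (simp only: scaleR_scaleR) simp
    then have eq: "x - z + ((t + 1) / 2) *\<^sub>R (2 *\<^sub>R z) = x + t *\<^sub>R z" "x - z + 2 *\<^sub>R z = x + z"
      by (simp_all add: scaleR_left_distrib) (simp add: scaleR_2)
    show ?thesis
      using segment_subset[of "x - z" "2 *\<^sub>R z" "(t + 1) / 2", unfolded eq] xz that by auto
  qed
  have "((\<lambda>t. f (x + t *\<^sub>R z) + f (x + t *\<^sub>R (- z))) has_real_derivative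
      g (x + t *\<^sub>R z) \<bullet> z + g (x + t *\<^sub>R (- z)) \<bullet> (- z)) (at t)" if "0 \<le> t" "t \<le> 1" for t
    using line[of t] line[of "- t"] that by (intro DERIV_add derivative_along) auto
  then obtain t where t: "0 < t" "t < 1"
    "f (x + z) + f (x - z) - 2 * f x = g (x + t *\<^sub>R z) \<bullet> z - g (x - t *\<^sub>R z) \<bullet> z"
    using MVT2[of 0 1 "\<lambda>t. f (x + t *\<^sub>R z) + f (x + t *\<^sub>R (- z))"
        "\<lambda>t. g (x + t *\<^sub>R z) \<bullet> z + g (x + t *\<^sub>R (- z)) \<bullet> (- z)"] by auto
  have "((\<lambda>t. g (x + t *\<^sub>R z) \<bullet> z) has_real_derivative Q (x + s *\<^sub>R z) z) (at s)"
    if "- t \<le> s" "s \<le> t" for s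
    using line[of s] that t by (intro second_derivative_along) auto
  then obtain s where s: "- t < s" "s < t"
    "g (x + t *\<^sub>R z) \<bullet> z - g (x - t *\<^sub>R z) \<bullet> z = 2 * t * Q (x + s *\<^sub>R z) z"
    using MVT2[of "- t" t "\<lambda>t. g (x + t *\<^sub>R z) \<bullet> z" "\<lambda>s. Q (x + s *\<^sub>R z) z"] t by auto
  have "\<bar>2 * t * Q (x + s *\<^sub>R z) z\<bar> \<le> 2 * 1 * M"
    unfolding abs_mult using t s M[of s] by (intro mult_mono) auto
  then show ?thesis using s t by simp
qed

text \<open>
  Two applications of the mean value theorem on the segment from \<open>x0\<close> to \<open>y\<close> bring in \<open>Q\<close>
  at an intermediate point, where it is small because it vanishes at \<open>x0\<close> and is Lipschitz.
\<close>
lemma cubic_vanishing: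
  assumes x0: "x0 \<in> S" "f x0 = 0" "g x0 = 0" "\<And>z. Q x0 z = 0" and y: "y \<in> S"
  shows "\<bar>f y\<bar> \<le> L * norm (y - x0) ^ 3"
proof -
  define z where "z = y - x0"
  obtain t where t: "0 < t" "t < 1" "f y = g (x0 + t *\<^sub>R z) \<bullet> z"
    using mean_value[of x0 z] x0 y by (auto simp: z_def)
  have seg: "x0 + s *\<^sub>R z \<in> S" if "0 \<le> s" "s \<le> 1" for s
    using segment_subset[of x0 z s] x0 y that by (simp add: z_def)
  have "((\<lambda>t. g (x0 + t *\<^sub>R z) \<bullet> z) has_real_derivative Q (x0 + s *\<^sub>R z) z) (at s)"
    if "0 \<le> s" "s \<le> t" for s
    using seg[of s] that t by (intro second_derivative_along) auto
  then obtain s where s: "0 < s" "s < t" "f y = t * Q (x0 + s *\<^sub>R z) z"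
    using MVT2[of 0 t "\<lambda>t. g (x0 + t *\<^sub>R z) \<bullet> z" "\<lambda>s. Q (x0 + s *\<^sub>R z) z"] t x0 by auto
  have "\<bar>Q (x0 + s *\<^sub>R z) z\<bar> \<le> L * (s * norm z) * norm z ^ 2"
    using hessian_lip[of "x0 + s *\<^sub>R z" x0 z] seg[of s] x0 s t by simp
  also have "\<dots> \<le> L * (1 * norm z) * norm z ^ 2"
    using s t L_nonneg by (intro mult_right_mono mult_left_mono) auto
  finally have Q: "\<bar>Q (x0 + s *\<^sub>R z) z\<bar> \<le> L * norm z ^ 3" by (simp add: power3_eq_cube power2_eq_square)
  have "\<bar>t * Q (x0 + s *\<^sub>R z) z\<bar> \<le> 1 * (L * norm z ^ 3)"
    unfolding abs_mult using Q t by (intro mult_mono) auto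
  then show ?thesis using s by (simp add: z_def)
qed

end

text \<open>
  The third derivatives are continuous, hence bounded on the compact convex set, which makes the second ones
  Lipschitz there.
\<close>
lemma Ck_on_3_imp_hessian_lipschitz:
  fixes f :: "real ^ 'n \<Rightarrow> real"
  assumes f: "Ck_on 3 f U" and S: "compact S'" "convex S'" "S' \<subseteq> U" "convex S" "S \<subseteq> S'"
  obtains g Q L where "hessian_lipschitz S f g Q L"
proof -
  from f have "Ck_on (Suc (Suc (Suc 0))) f U" by (simp add: numeral_3_eq_3)
  then obtain g where g: "\<And>x. x \<in> U \<Longrightarrow> GDERIV f x :> g x"
    "\<And>i. Ck_on (Suc (Suc 0)) (\<lambda>x. g x $ i) U" unfolding Ck_on.simps(2)[of "Suc (Suc 0)"] by blast
  have "\<exists>h. \<forall>i. (\<forall>x\<in>U. GDERIV (\<lambda>x. g x $ i) x :> h i x) \<and> (\<forall>j. Ck_on (Suc 0) (\<lambda>x. h i x $ j) U)"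
    using g(2) unfolding Ck_on.simps(2)[of "Suc 0"] by (intro choice) blast
  then obtain h where h: "\<And>i x. x \<in> U \<Longrightarrow> GDERIV (\<lambda>x. g x $ i) x :> h i x"
    "\<And>i j. Ck_on (Suc 0) (\<lambda>x. h i x $ j) U" by blast
  obtain L1 where L1: "0 \<le> L1" "\<And>y. y \<in> S' \<Longrightarrow> norm (g y) \<le> L1"
    "\<And>y y'. y \<in> S' \<Longrightarrow> y' \<in> S' \<Longrightarrow> norm (g y - g y') \<le> L1 * norm (y - y')"
    using Ck_on_components_imp_bounded_lipschitz[of "Suc 0" g U S', OF g(2) S(1-3)] by blast
  have "\<exists>L. \<forall>i. 0 \<le> L i \<and> (\<forall>y\<in>S'. norm (h i y) \<le> L i \<and>
      (\<forall>y'\<in>S'. norm (h i y - h i y') \<le> L i * norm (y - y')))"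
    using Ck_on_components_imp_bounded_lipschitz[of 0 "h _" U S', OF h(2) S(1-3)] by (intro choice) blast
  then obtain L2 where L2: "\<And>i. 0 \<le> L2 i" "\<And>i y. y \<in> S' \<Longrightarrow> norm (h i y) \<le> L2 i"
    "\<And>i y y'. y \<in> S' \<Longrightarrow> y' \<in> S' \<Longrightarrow> norm (h i y - h i y') \<le> L2 i * norm (y - y')" by blast
  define L where "L = L1 + (\<Sum>i\<in>UNIV. L2 i)"
  define Q where "Q = (\<lambda>y z. \<Sum>i\<in>UNIV. (h i y \<bullet> z) * z $ i)"
  have L12: "L1 \<le> L" "(\<Sum>i\<in>UNIV. L2 i) \<le> L"
    using L1(1) L2(1) by (auto simp: L_def intro: sum_nonneg)
  have Q_le: "\<bar>\<Sum>i\<in>UNIV. (v i \<bullet> z) * z $ i\<bar> \<le> L * c * norm z ^ 2"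
    if v: "\<And>i. norm (v i) \<le> L2 i * c" and c: "0 \<le> c" for v :: "'n \<Rightarrow> real ^ 'n" and z c
  proof -
    have "\<bar>\<Sum>i\<in>UNIV. (v i \<bullet> z) * z $ i\<bar> \<le> (\<Sum>i\<in>UNIV. \<bar>v i \<bullet> z\<bar> * \<bar>z $ i\<bar>)"
      by (rule order.trans[OF sum_abs]) (simp add: abs_mult)
    also have "\<dots> \<le> (\<Sum>i\<in>UNIV. (L2 i * c * norm z) * norm z)"
    proof (intro sum_mono mult_mono component_le_norm_cart)
      fix i
      show "\<bar>v i \<bullet> z\<bar> \<le> L2 i * c * norm z"
        by (rule order.trans[OF Cauchy_Schwarz_ineq2]) (intro mult_right_mono v norm_ge_zero)
    qed (use c L2 in auto)
    also have "\<dots> = (\<Sum>i\<in>UNIV. L2 i) * (c * norm z ^ 2)"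
      unfolding sum_distrib_right by (simp add: power2_eq_square ac_simps)
    also have "\<dots> \<le> L * (c * norm z ^ 2)" using L12 c by (intro mult_right_mono) auto
    finally show ?thesis by (simp add: ac_simps)
  qed
  have "hessian_lipschitz S f g Q L"
  proof
    show "convex S" by fact
    show "0 \<le> L" using L1 L12 by simp
  next
    fix y z assume "y \<in> S"
    then have y: "y \<in> U" "y \<in> S'" using S by auto
    show "GDERIV f y :> g y" using g y by auto
    have "((\<lambda>t. \<Sum>i\<in>UNIV. g (y + t *\<^sub>R z) $ i * z $ i) has_real_derivative Q y z) (at 0)"
      unfolding Q_def using h(1)[OF y(1)]
      by (intro DERIV_sum DERIV_cmult_right GDERIV_along_line[where t=0, simplified]) auto
    then show "((\<lambda>t. g (y + t *\<^sub>R z) \<bullet> z) has_real_derivative Q y z) (at 0)"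
      by (simp add: inner_vec_def)
    show "norm (g y) \<le> L" using L1(2)[OF y(2)] L12 by simp
    show "\<bar>Q y z\<bar> \<le> L * (norm z)\<^sup>2"
      using Q_le[of "\<lambda>i. h i y" 1 z] L2 y by (simp add: Q_def)
    fix y' assume "y' \<in> S"
    then have y': "y' \<in> U" "y' \<in> S'" using S by auto
    show "norm (g y - g y') \<le> L * norm (y - y')"
      by (rule order.trans[OF L1(3)[OF y(2) y'(2)]]) (intro mult_right_mono L12 norm_ge_zero)
    have "Q y z - Q y' z = (\<Sum>i\<in>UNIV. ((h i y - h i y') \<bullet> z) * z $ i)"
      by (simp add: Q_def sum_subtractf inner_diff_left left_diff_distrib)
    then show "\<bar>Q y z - Q y' z\<bar> \<le> L * norm (y - y') * (norm z)\<^sup>2"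
      using Q_le[of "\<lambda>i. h i y - h i y'" "norm (y - y')" z] L2 y y' by simp
  qed
  then show ?thesis by (rule that)
qed

text \<open>
  If \<open>q\<close> were positive, \<open>\<phi>\<close> would have a strict local minimum at 0, contrary to \<open>\<phi> \<le> 0\<close> on the left;
  if it were negative, a strict local maximum, contrary to \<open>\<phi> \<ge> 0\<close> on the right.
\<close>
lemma second_derivative_zero_at_sign_change:
  fixes \<phi> \<psi> :: "real \<Rightarrow> real"
  assumes d: "0 < d" and deriv: "\<And>t. \<bar>t\<bar> < d \<Longrightarrow> (\<phi> has_real_derivative \<psi> t) (at t)"
    and deriv2: "(\<psi> has_real_derivative q) (at 0)" and zero: "\<phi> 0 = 0" "\<psi> 0 = 0"
    and pos: "\<And>t. 0 < t \<Longrightarrow> t < d \<Longrightarrow> 0 \<le> \<phi> t"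
    and neg: "\<And>t. - d < t \<Longrightarrow> t < 0 \<Longrightarrow> \<phi> t \<le> 0"
  shows "q = 0"
proof (rule ccontr)
  assume "q \<noteq> 0"
  then consider "0 < q" | "q < 0" by linarith
  then show False
  proof cases
    case 1
    then obtain d' where d': "0 < d'" "\<And>h. 0 < h \<Longrightarrow> h < d' \<Longrightarrow> \<psi> (- h) < 0"
      using DERIV_pos_inc_left[OF deriv2] zero by auto
    define h where "h = min d d' / 2"
    have h: "0 < h" "h < d" "h < d'" using d d' by (auto simp: h_def)
    obtain s where "- h < s" "s < 0" "\<phi> 0 - \<phi> (- h) = h * \<psi> s"
      using MVT2[of "- h" 0 \<phi> \<psi>] deriv h by auto
    moreover from this have "\<psi> s < 0" using d'(2)[of "- s"] h by simp
    then have "h * \<psi> s < 0" using h by (simp add: mult_pos_neg)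
    ultimately show False using neg[of "- h"] h zero by simp
  next
    case 2
    then obtain d' where d': "0 < d'" "\<And>h. 0 < h \<Longrightarrow> h < d' \<Longrightarrow> \<psi> h < 0"
      using DERIV_neg_dec_right[OF deriv2] zero by auto
    define h where "h = min d d' / 2"
    have h: "0 < h" "h < d" "h < d'" using d d' by (auto simp: h_def)
    obtain s where s: "0 < s" "s < h" "\<phi> h - \<phi> 0 = h * \<psi> s"
      using MVT2[of 0 h \<phi> \<psi>] deriv h by auto
    then have "h * \<psi> s < 0" using h d'(2)[of s] by (simp add: mult_pos_neg)
    then show False using pos[of h] h zero s by simp
  qed
qed

section \<open>Reflection in a hyperplane\<close>

lemma reflect_component: "reflect e l x $ i = (if i = e then 2 * l - x $ i else x $ i)"
  by (simp add: reflect_def)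

lemma reflect_reflect [simp]: "reflect e l (reflect e l x) = x"
  by (simp add: vec_eq_iff reflect_component)

lemma reflect_fixed: "x $ e = l \<Longrightarrow> reflect e l x = x"
  by (simp add: vec_eq_iff reflect_component)

lemma reflect_add_scaleR: "reflect e l (x + t *\<^sub>R z) = reflect e l x + t *\<^sub>R reflect e 0 z"
  by (simp add: vec_eq_iff reflect_component)

lemma inner_reflect: "reflect e 0 x \<bullet> y = x \<bullet> reflect e 0 y"
  unfolding inner_vec_def by (intro sum.cong) (auto simp: reflect_component)

lemma norm_reflect [simp]: "norm (reflect e 0 x) = norm x"
  by (simp add: norm_eq_sqrt_inner inner_reflect)

lemma reflect_diff: "reflect e l x - reflect e l y = reflect e 0 (x - y)"
  by (simp add: vec_eq_iff reflect_component)

lemma norm_reflect_diff: "norm (reflect e l x - reflect e l y) = norm (x - y)"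
  by (simp add: reflect_diff)

lemma reflect_in_ball:
  assumes "x0 $ e = l" shows "reflect e l y \<in> ball x0 R \<longleftrightarrow> y \<in> ball x0 R"
  using norm_reflect_diff[of e l x0 y] reflect_fixed[OF assms] by (simp add: dist_norm)

text \<open>
  In the half-space, reflecting \<open>y\<close> increases its squared distance to \<open>x\<close> by four times the product of the
  distances of the two points to the hyperplane. This is why the kernel favours \<open>y\<close> over its reflection, by
  an amount of the order of the distance of \<open>x\<close> to the hyperplane.
\<close>
lemma norm_diff_reflect_power2:
  fixes x y :: "real ^ 'n"
  shows   "norm (x - reflect e l y) ^ 2 = norm (x - y) ^ 2 + 4 * (x $ e - l) * (y $ e - l)"
proof -
  have norm2: "norm v ^ 2 = (\<Sum>i\<in>UNIV. (v $ i)^2)" for v :: "real ^ 'n"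
    unfolding power2_norm_eq_inner inner_vec_def by (simp add: power2_eq_square)
  have "norm (x - reflect e l y) ^ 2 - norm (x - y) ^ 2
      = (\<Sum>i\<in>UNIV. ((x - reflect e l y) $ i)^2 - ((x - y) $ i)^2)"
    by (simp add: norm2 sum_subtractf)
  also have "\<dots> = (\<Sum>i\<in>UNIV. if i = e then 4 * (x $ e - l) * (y $ e - l) else 0)"
    by (intro sum.cong) (auto simp: reflect_component power2_eq_square algebra_simps)
  finally show ?thesis by simp
qed

lemma GDERIV_reflect:
  assumes "GDERIV f (reflect e l y) :> D"
  shows "GDERIV (\<lambda>x. f (reflect e l x)) y :> reflect e 0 D"
proof -
  have lin: "bounded_linear (reflect e 0)"
    by (rule bounded_linear_intro[where K = 1])
       (auto simp: vec_eq_iff reflect_component)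
  have "reflect e l = (\<lambda>x. reflect e l 0 + reflect e 0 x)"
    by (auto simp: vec_eq_iff reflect_component)
  moreover have "((\<lambda>x. reflect e l 0 + reflect e 0 x) has_derivative reflect e 0) (at y)"
    using has_derivative_add[OF has_derivative_const bounded_linear_imp_has_derivative[OF lin]]
    by simp
  ultimately have "(reflect e l has_derivative reflect e 0) (at y)" by metis
  from has_derivative_compose[OF this, of f "\<lambda>h. h \<bullet> D"] assms show ?thesis
    by (simp add: gderiv_def inner_reflect)
qed

lemma hessian_lipschitz_mono:
  assumes "hessian_lipschitz S f g Q L" "L \<le> L'"
  shows "hessian_lipschitz S f g Q L'"
proof -
  interpret hessian_lipschitz S f g Q L by fact
  have le: "a \<le> L * b \<Longrightarrow> 0 \<le> b \<Longrightarrow> a \<le> L' * b" for a b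
    using mult_right_mono[OF assms(2), of b] by linarith
  show ?thesis
  proof
    fix y y' z assume "y \<in> S" "y' \<in> S"
    then show "norm (g y - g y') \<le> L' * norm (y - y')" "\<bar>Q y z - Q y' z\<bar> \<le> L' * norm (y - y') * (norm z)\<^sup>2"
      "norm (g y) \<le> L'"
      using le[OF gradient_lipschitz] le[of "\<bar>Q y z - Q y' z\<bar>" "norm (y - y') * (norm z)\<^sup>2"]
        hessian_lip gradient_bound[of y] assms(2)
      by (auto simp: mult.assoc)
  next
    fix y z assume "y \<in> S"
    then show "\<bar>Q y z\<bar> \<le> L' * (norm z)\<^sup>2" using le[OF hessian_bound] by simp
  qed (use convex gradient hessian L_nonneg assms in auto)
qed

lemma hessian_lipschitz_reflect_diff:
  fixes f :: "real ^ 'n \<Rightarrow> real"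
  assumes "hessian_lipschitz S f g Q L" and S: "\<And>y. y \<in> S \<Longrightarrow> reflect e l y \<in> S"
  shows "hessian_lipschitz S (\<lambda>x. f (reflect e l x) - f x)
    (\<lambda>x. reflect e 0 (g (reflect e l x)) - g x)
    (\<lambda>x z. Q (reflect e l x) (reflect e 0 z) - Q x z) (2 * L)"
proof -
  interpret hessian_lipschitz S f g Q L by fact
  show ?thesis
  proof
    show "convex S" "0 \<le> 2 * L" using convex L_nonneg by auto
  next
    fix y z assume y: "y \<in> S"
    show "GDERIV (\<lambda>x. f (reflect e l x) - f x) y :> reflect e 0 (g (reflect e l y)) - g y"
      using y S by (intro GDERIV_diff GDERIV_reflect gradient)
    have "((\<lambda>t. g (reflect e l y + t *\<^sub>R reflect e 0 z) \<bullet> reflect e 0 z - g (y + t *\<^sub>R z) \<bullet> z)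
        has_real_derivative Q (reflect e l y) (reflect e 0 z) - Q y z) (at 0)"
      using y S by (intro DERIV_diff hessian)
    then show "((\<lambda>t. (reflect e 0 (g (reflect e l (y + t *\<^sub>R z))) - g (y + t *\<^sub>R z)) \<bullet> z)
        has_real_derivative Q (reflect e l y) (reflect e 0 z) - Q y z) (at 0)"
      by (simp add: reflect_add_scaleR inner_diff_left inner_reflect)
    show "norm (reflect e 0 (g (reflect e l y)) - g y) \<le> 2 * L"
      by (rule norm_triangle_le_diff)
         (use gradient_bound[OF y] gradient_bound[OF S[OF y]] in simp)
    show "\<bar>Q (reflect e l y) (reflect e 0 z) - Q y z\<bar> \<le> 2 * L * (norm z)\<^sup>2"
      using hessian_bound[OF y, of z] hessian_bound[OF S[OF y], of "reflect e 0 z"] by simp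
    fix y' assume y': "y' \<in> S"
    have "norm ((reflect e 0 (g (reflect e l y)) - reflect e 0 (g (reflect e l y'))) - (g y - g y'))
        \<le> 2 * L * norm (y - y')"
      by (rule norm_triangle_le_diff)
         (use gradient_lipschitz[OF y y'] gradient_lipschitz[OF S[OF y] S[OF y']] in
           \<open>simp add: reflect_diff norm_reflect_diff\<close>)
    then show "norm (reflect e 0 (g (reflect e l y)) - g y - (reflect e 0 (g (reflect e l y')) - g y'))
        \<le> 2 * L * norm (y - y')" by (simp add: algebra_simps)
    show "\<bar>Q (reflect e l y) (reflect e 0 z) - Q y z - (Q (reflect e l y') (reflect e 0 z) - Q y' z)\<bar>
        \<le> 2 * L * norm (y - y') * (norm z)\<^sup>2"
      using hessian_lip[OF y y', of z] hessian_lip[OF S[OF y] S[OF y'], of "reflect e 0 z"]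
      by (simp add: norm_reflect_diff)
  qed
qed

text \<open>
  Tangential derivatives vanish because \<open>w\<close> is zero on the hyperplane, and the normal one because
  it is both \<open>\<ge> 0\<close> and \<open>\<le> 0\<close>. On each line through \<open>x0\<close> the sign of \<open>w\<close> then changes at \<open>x0\<close> (or
  \<open>w\<close> is zero there), so the second derivative along the line vanishes too.
\<close>
lemma flat_at_contact:
  fixes w :: "real ^ 'n \<Rightarrow> real"
  assumes "hessian_lipschitz (ball x0 R) w g Q L" and R: "0 < R" and x0: "x0 $ e = l"
    and pos: "\<And>y. l < y $ e \<Longrightarrow> 0 \<le> w y" and zero: "\<And>y. y $ e = l \<Longrightarrow> w y = 0"
    and neg: "\<And>y. y $ e < l \<Longrightarrow> w y \<le> 0"
    and normal: "g x0 $ e \<le> 0"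
  shows "g x0 = 0" and "Q x0 z = 0"
proof -
  interpret hessian_lipschitz "ball x0 R" w g Q L by fact
  define \<delta> where "\<delta> z = R / (norm z + 1)" for z :: "real ^ 'n"
  have \<delta>: "0 < \<delta> z" for z using R by (auto simp: \<delta>_def intro!: divide_pos_pos add_nonneg_pos)
  have line: "x0 + t *\<^sub>R z \<in> ball x0 R" if "\<bar>t\<bar> < \<delta> z" for t z
  proof -
    have "\<bar>t\<bar> * norm z \<le> \<bar>t\<bar> * (norm z + 1)" by (intro mult_left_mono) auto
    also have "\<dots> < R" using that by (simp add: \<delta>_def pos_less_divide_eq add_nonneg_pos)
    finally show ?thesis by (simp add: dist_norm)
  qed
  have d1: "((\<lambda>t. w (x0 + t *\<^sub>R z)) has_real_derivative g (x0 + t *\<^sub>R z) \<bullet> z) (at t)"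
    if "\<bar>t\<bar> < \<delta> z" for t z using line[OF that] by (rule derivative_along)
  have d0: "((\<lambda>t. w (x0 + t *\<^sub>R z)) has_real_derivative g x0 \<bullet> z) (at 0)" for z
    using d1[of 0 z] \<delta> by simp
  have ez: "(x0 + t *\<^sub>R z) $ e = l + t * z $ e" for t z using x0 by simp
  have w0: "w x0 = 0" using zero x0 by simp
  have tang: "g x0 \<bullet> z = 0" if "z $ e = 0" for z
  proof -
    have "(\<lambda>t. w (x0 + t *\<^sub>R z)) = (\<lambda>t. 0)" using that zero by (intro ext) (simp add: x0)
    then show ?thesis using d0[of z] DERIV_unique[of "\<lambda>t. 0::real" "g x0 \<bullet> z" 0 0] by simp
  qed
  have "0 \<le> g x0 $ e"
  proof (rule ccontr)
    assume "\<not> 0 \<le> g x0 $ e"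
    then have "g x0 \<bullet> axis e 1 < 0" by (simp add: inner_axis)
    from DERIV_neg_dec_right[OF d0 this] obtain d where "0 < d"
      "\<And>h. 0 < h \<Longrightarrow> h < d \<Longrightarrow> w (x0 + h *\<^sub>R axis e 1) < 0" by (auto simp: w0)
    then have "w (x0 + (d / 2) *\<^sub>R axis e 1) < 0" by simp
    then show False using pos[of "x0 + (d / 2) *\<^sub>R axis e 1"] \<open>0 < d\<close> by (simp add: x0)
  qed
  then have "g x0 $ e = 0" using normal by simp
  moreover have "g x0 $ i = 0" if "i \<noteq> e" for i
    using tang[of "axis i 1"] that by (simp add: inner_axis) (simp add: axis_def)
  ultimately show g0: "g x0 = 0" by (metis vec_eq_iff zero_index)
  have pt: "0 \<le> w (x0 + t *\<^sub>R z)" if "0 \<le> t * z $ e" for t z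
    using that pos[of "x0 + t *\<^sub>R z"] zero[of "x0 + t *\<^sub>R z"] by (cases "t * z $ e = 0") (auto simp: x0)
  have nt: "w (x0 + t *\<^sub>R z) \<le> 0" if "t * z $ e \<le> 0" for t z
    using that neg[of "x0 + t *\<^sub>R z"] zero[of "x0 + t *\<^sub>R z"] by (cases "t * z $ e = 0") (auto simp: x0)
  have d2: "((\<lambda>t. g (x0 + t *\<^sub>R z) \<bullet> z) has_real_derivative Q x0 z) (at 0)"
    using R by (intro hessian) auto
  show "Q x0 z = 0"
  proof (cases "0 \<le> z $ e")
    case True
    show ?thesis
    proof (rule second_derivative_zero_at_sign_change[OF \<delta> d1 d2])
      show "0 \<le> w (x0 + t *\<^sub>R z)" if "0 < t" for t using that True by (intro pt) simp
      show "w (x0 + t *\<^sub>R z) \<le> 0" if "t < 0" for t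
        using that True by (intro nt) (simp add: mult_nonpos_nonneg)
    qed (simp_all add: w0 g0)
  next
    case False
    have "- Q x0 z = 0"
    proof (rule second_derivative_zero_at_sign_change[OF \<delta> DERIV_minus[OF d1] DERIV_minus[OF d2]])
      show "0 \<le> - w (x0 + t *\<^sub>R z)" if "0 < t" for t
        using that False nt[of t z] by (simp add: mult_nonneg_nonpos)
      show "- w (x0 + t *\<^sub>R z) \<le> 0" if "t < 0" for t
        using that False pt[of t z] by (simp add: mult_nonpos_nonpos)
    qed (simp_all add: w0 g0)
    then show ?thesis by simp
  qed
qed

section \<open>Pointwise estimates at a flat boundary point\<close>

text \<open>
  The situation to be refuted: \<open>x0\<close> is a boundary point at which \<open>w\<close> vanishes to third
  order. The bound \<open>R \<le> 1 / 2\<close> keeps all distances in the ball below 1, so that powers of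
  distances decrease in the exponent.
\<close>
locale hopf_contact = u: hessian_lipschitz "ball x0 R" u gu Qu L + w: hessian_lipschitz "ball x0 R" w gw Qw L
  for x0 :: "real ^ 'n::finite" and R L :: real and u w gu gw Qu Qw +
  fixes s p l :: real and e :: 'n
  assumes s: "0 < s" "s < 1" and p: "3 \<le> p" and R: "0 < R" "R \<le> 1 / 2"
    and x0: "x0 $ e = l"
    and w_eq: "w y = u (reflect e l y) - u y"
    and w_pos: "l < y $ e \<Longrightarrow> 0 < w y"
    and flat: "gw x0 = 0" "Qw x0 z = 0"
begin

definition q :: real where "q = real CARD('n) + p * s"

text \<open>
  The weight produced near \<open>x\<close> is \<open>|x - y|^(p (1 - s) - n)\<close>, and \<open>2 * k0 \<le> p * (1 - s)\<close>. One copy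
  of \<open>k0\<close> keeps \<open>|x - y|^(k0 - n)\<close> integrable; the other is turned into the factor \<open>(d / 2)^k0\<close>,
  which tends to zero. The cap at 1 ensures \<open>k0 - 2 < 0\<close> and \<open>k0 \<le> n\<close>.
\<close>
definition k0 :: real where "k0 = min (p * (1 - s) / 2) 1"

definition ul :: "real ^ 'n \<Rightarrow> real" where "ul y = u (reflect e l y)"

text \<open>
  \<open>H x y\<close> is the difference at \<open>y\<close> of the integrands of the operators applied to \<open>ul\<close> and to \<open>u\<close>, and \<open>F x y\<close> its
  numerator. \<open>P x b\<close> is what remains of the numerator when both functions take the value \<open>b\<close> at \<open>y\<close>; it only
  measures the small quantity \<open>w x\<close>.
\<close>
definition F :: "real ^ 'n \<Rightarrow> real ^ 'n \<Rightarrow> real" where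
  "F x y = ppow p (ul x - ul y) - ppow p (u x - u y)"

definition H :: "real ^ 'n \<Rightarrow> real ^ 'n \<Rightarrow> real" where
  "H x y = F x y / norm (x - y) powr q"

definition P :: "real ^ 'n \<Rightarrow> real \<Rightarrow> real" where
  "P x b = ppow p (ul x - b) - ppow p (u x - b)"

lemma k0: "0 < k0" "k0 \<le> 1" "2 * k0 \<le> p * (1 - s)"
  using s p by (auto simp: k0_def min_def)

lemma q: "real CARD('n) < q" "0 < q"
  using s p by (auto simp: q_def add_nonneg_pos)

lemma L_nonneg: "0 \<le> L" by (rule u.L_nonneg)

lemma w_ul: "w y = ul y - u y" by (simp add: w_eq ul_def)

lemma u_reflect: "u (reflect e l y) = ul y" "ul (reflect e l y) = u y" by (simp_all add: ul_def)

lemma w_nonneg: "l \<le> y $ e \<Longrightarrow> 0 \<le> w y"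
  using w_pos[of y] by (cases "y $ e = l") (auto simp: w_eq reflect_fixed)

lemma w_cubic: "y \<in> ball x0 R \<Longrightarrow> \<bar>w y\<bar> \<le> L * norm (y - x0) ^ 3"
  using flat R by (intro w.cubic_vanishing) (auto simp: w_eq reflect_fixed x0)

text \<open>
  \<open>B1\<close>, \<open>B2\<close>, \<open>B3\<close> are the constants in front of the contributions of the ball of radius \<open>d / 2\<close>, of the rest
  of \<open>ball x0 R\<close>, and of its complement. On \<open>ball x0 R\<close> the function \<open>\<bar>u\<bar>\<close> is at most \<open>u_bound\<close>, and \<open>far_ratio\<close> compares
  \<open>norm y\<close> with \<open>norm (x - y)\<close> outside it.
\<close>
definition B1 :: real where
  "B1 = (p - 1) * (2 * L) powr (p - 2) * (4 * L) + (p - 1) * (p - 2) * (2 * L) powr (p - 3) * (4 * L ^ 2)"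

definition B2 :: real where "B2 = (p - 1) * (2 * L) powr (p - 2) * (9 * L)"

definition u_bound :: real where "u_bound = \<bar>u x0\<bar> + L"

definition far_ratio :: real where "far_ratio = (norm x0 + 1) * (2 / R) + 1"

definition B3 :: real where
  "B3 = (p - 1) * L * (2 * (1 + u_bound)) powr (p - 1) * (2 * far_ratio powr q)"

lemma B_nonneg: "0 \<le> B1" "0 \<le> B2" "0 \<le> B3" "0 \<le> u_bound"
  using L_nonneg p by (auto simp: B1_def B2_def B3_def u_bound_def)

context
  fixes d :: real and x :: "real ^ 'n"
  assumes d: "0 < d" "8 * d < R" and x: "x = x0 + d *\<^sub>R axis e 1"
begin

lemma norm_x: "norm (x - x0) = d" using d by (simp add: x)

lemma x_e: "x $ e = l + d" by (simp add: x x0)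

lemma d_small: "d < 1 / 16" using d R by simp

lemma near_in_ball: "norm (y - x) < R - d \<Longrightarrow> y \<in> ball x0 R"
  using norm_triangle_ineq[of "y - x" "x - x0"] norm_x by (simp add: dist_norm norm_minus_commute)

lemma x_in_ball: "x \<in> ball x0 R" using near_in_ball[of x] d R by simp

lemma w_x: "0 \<le> w x" "w x \<le> L * d ^ 3"
  using w_cubic[OF x_in_ball] w_nonneg[of x] d by (auto simp: norm_x x_e)

text \<open>
  With \<open>a\<close>, \<open>b\<close> the increments of \<open>u\<close> and \<open>w\<close> from \<open>x + z\<close> to \<open>x\<close>, and \<open>a'\<close>, \<open>b'\<close> those from \<open>x\<close> to
  \<open>x - z\<close>, oddness of \<open>ppow\<close> turns the sum into \<open>ppow (a + b) - ppow a\<close> minus the same expression in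
  \<open>a'\<close>, \<open>b'\<close>. Both \<open>a - a'\<close> and \<open>b - b'\<close> are second differences, of order \<open>|z|^2\<close> and
  \<open>d |z|^2\<close>. Replacing \<open>b\<close> by \<open>b'\<close> costs a first increment of \<open>ppow\<close>, replacing \<open>a\<close> by
  \<open>a'\<close> a second one with step \<open>b' = O(d |z|)\<close>.
\<close>
lemma inner_pair_le:
  assumes z: "norm z < d / 2"
  shows "F x (x + z) + F x (x - z) \<le> B1 * d * norm z powr p"
proof (cases "z = 0")
  case True
  then show ?thesis by (simp add: F_def ppow_def)
next
  case False
  then have t: "0 < norm z" by simp
  define t where "t = norm z"
  have ball: "x + z \<in> ball x0 R" "x - z \<in> ball x0 R" 
    by (rule near_in_ball, use z d in simp)+
  define a where "a = u x - u (x + z)"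
  define a' where "a' = u (x - z) - u x"
  define b where "b = w x - w (x + z)"
  define b' where "b' = w (x - z) - w x"
  have a: "\<bar>a\<bar> \<le> L * t" and a': "\<bar>a'\<bar> \<le> L * t"
    using u.lipschitz[OF x_in_ball ball(1)] u.lipschitz[OF ball(2) x_in_ball]
    by (auto simp: a_def a'_def t_def)
  have b: "\<bar>b\<bar> \<le> L * t" and b'1: "\<bar>b'\<bar> \<le> L * t"
    using w.lipschitz[OF x_in_ball ball(1)] w.lipschitz[OF ball(2) x_in_ball]
    by (auto simp: b_def b'_def t_def)
  have close: "norm (x + r *\<^sub>R z - x0) \<le> 2 * d" if "\<bar>r\<bar> \<le> 1" for r
  proof -
    have "norm (r *\<^sub>R z) \<le> 1 * norm z" using that unfolding norm_scaleR by (intro mult_right_mono) auto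
    then show ?thesis
      using norm_triangle_ineq[of "x - x0" "r *\<^sub>R z"] norm_x z d by (simp add: algebra_simps)
  qed
  have in_ball: "x + r *\<^sub>R z \<in> ball x0 R" if "\<bar>r\<bar> \<le> 1" for r
    using close[OF that] d by (simp add: dist_norm norm_minus_commute)
  have aa': "\<bar>a - a'\<bar> \<le> 2 * (L * t ^ 2)"
  proof -
    have "\<bar>u (x + z) + u (x - z) - 2 * u x\<bar> \<le> 2 * (L * t ^ 2)"
      using in_ball by (intro u.second_difference_le[OF ball]) (auto simp: t_def intro: u.hessian_bound)
    then show ?thesis by (simp add: a_def a'_def)
  qed
  have bb': "\<bar>b - b'\<bar> \<le> 2 * (L * (2 * d) * t ^ 2)"
  proof -
    have "\<bar>w (x + z) + w (x - z) - 2 * w x\<bar> \<le> 2 * (L * (2 * d) * t ^ 2)"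
    proof (rule w.second_difference_le[OF ball])
      fix r :: real assume r: "\<bar>r\<bar> \<le> 1"
      have "\<bar>Qw (x + r *\<^sub>R z) z\<bar> \<le> L * norm (x + r *\<^sub>R z - x0) * norm z ^ 2"
        using w.hessian_lip[OF in_ball[OF r], of x0 z] flat R by simp
      also have "\<dots> \<le> L * (2 * d) * t ^ 2"
        unfolding t_def using close[OF r] L_nonneg d by (intro mult_mono) auto
      finally show "\<bar>Qw (x + r *\<^sub>R z) z\<bar> \<le> L * (2 * d) * t ^ 2" .
    qed
    then show ?thesis by (simp add: b_def b'_def)
  qed
  have b': "\<bar>b'\<bar> \<le> 2 * d * L * t"
  proof -
    obtain r where r: "0 < r" "r < 1" "w (x + - z) - w x = gw (x + r *\<^sub>R (- z)) \<bullet> (- z)"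
      using w.mean_value[of x "- z"] x_in_ball ball by auto
    have "\<bar>b'\<bar> \<le> norm (gw (x + r *\<^sub>R (- z))) * norm z"
      using Cauchy_Schwarz_ineq2[of "gw (x + r *\<^sub>R (- z))" "- z"] r by (simp add: b'_def)
    also have "norm (gw (x + r *\<^sub>R (- z))) \<le> L * norm (x + (- r) *\<^sub>R z - x0)"
      using w.gradient_lipschitz[OF in_ball[of "- r"], of x0] flat R r by simp
    also have "\<dots> \<le> L * (2 * d)" using close[of "- r"] r L_nonneg by (intro mult_left_mono) auto
    finally show ?thesis by (simp add: t_def mult_right_mono ac_simps)
  qed
  have F1: "F x (x + z) = ppow p (a + b) - ppow p a" by (simp add: F_def a_def b_def w_ul algebra_simps)
  have F2: "F x (x - z) = - (ppow p (a' + b') - ppow p a')"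
  proof -
    have "ul x - ul (x - z) = - (a' + b')" "u x - u (x - z) = - a'"
      by (simp_all add: a'_def b'_def w_ul)
    then show ?thesis unfolding F_def by (simp only: ppow_minus)
  qed
  have "F x (x + z) + F x (x - z) = (ppow p (a + b) - ppow p (a + b'))
      + ((ppow p (a + b') - ppow p a) - (ppow p (a' + b') - ppow p a'))"
    by (simp add: F1 F2)
  also have "\<dots> \<le> (p - 1) * (2 * L * t) powr (p - 2) * (2 * (L * (2 * d) * t ^ 2))
      + (p - 1) * (p - 2) * (2 * L * t) powr (p - 3) * (2 * d * L * t) * (2 * (L * t ^ 2))"
  proof (rule add_mono)
    have "ppow p (a + b) - ppow p (a + b') \<le> \<bar>ppow p (a + b) - ppow p (a + b')\<bar>" by simp
    also have "\<dots> \<le> (p - 1) * (2 * L * t) powr (p - 2) * \<bar>(a + b) - (a + b')\<bar>"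
      using p a b b'1 by (intro ppow_abs_diff_le) auto
    also have "\<dots> \<le> (p - 1) * (2 * L * t) powr (p - 2) * (2 * (L * (2 * d) * t ^ 2))"
      using bb' p by (intro mult_left_mono) auto
    finally show "ppow p (a + b) - ppow p (a + b')
        \<le> (p - 1) * (2 * L * t) powr (p - 2) * (2 * (L * (2 * d) * t ^ 2))" .
  next
    have "(ppow p (a + b') - ppow p a) - (ppow p (a' + b') - ppow p a')
        \<le> \<bar>(ppow p (a + b') - ppow p a) - (ppow p (a' + b') - ppow p a')\<bar>" by simp
    also have "\<dots> \<le> (p - 1) * (p - 2) * (2 * L * t) powr (p - 3) * \<bar>b'\<bar> * \<bar>a - a'\<bar>"
      using p a a' b'1 L_nonneg by (intro ppow_second_diff_le) auto
    also have "\<dots> \<le> (p - 1) * (p - 2) * (2 * L * t) powr (p - 3) * (2 * d * L * t) * (2 * (L * t ^ 2))"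
      using b' aa' p d L_nonneg by (intro mult_mono) (auto simp: t_def intro!: mult_nonneg_nonneg)
    finally show "(ppow p (a + b') - ppow p a) - (ppow p (a' + b') - ppow p a')
        \<le> (p - 1) * (p - 2) * (2 * L * t) powr (p - 3) * (2 * d * L * t) * (2 * (L * t ^ 2))" .
  qed
  also have "\<dots> = B1 * d * t powr p"
  proof -
    have t0: "0 < t" using False by (simp add: t_def)
    have "t powr (p - 2) * t ^ 2 = t powr p" "t powr (p - 3) * t ^ 3 = t powr p"
      using t0 by (simp_all add: powr_add[symmetric] flip: powr_numeral)
    note * = this[symmetric]
    have "(p - 1) * (2 * L * t) powr (p - 2) * (2 * (L * (2 * d) * t ^ 2))
        = (p - 1) * (2 * L) powr (p - 2) * (4 * L) * d * (t powr p)"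
      unfolding *(1) using t0 L_nonneg by (simp add: powr_mult)
    moreover have "(p - 1) * (p - 2) * (2 * L * t) powr (p - 3) * (2 * d * L * t) * (2 * (L * t ^ 2))
        = (p - 1) * (p - 2) * (2 * L) powr (p - 3) * (4 * L ^ 2) * d * (t powr p)"
      unfolding *(2) using t0 L_nonneg by (simp add: powr_mult power2_eq_square power3_eq_cube)
    ultimately show ?thesis by (simp only: B1_def distrib_right)
  qed
  finally show ?thesis by (simp add: t_def)
qed

lemma inner_kernel_pair_le:
  assumes y: "norm (x - y) < d / 2"
  shows "H x y + H x (2 *\<^sub>R x - y)
    \<le> B1 * d * (d / 2) powr k0 * norm (x - y) powr (k0 - real CARD('n))"
proof (cases "y = x")
  case True
  then show ?thesis by (simp add: H_def scaleR_2)
next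
  case False
  define t where "t = norm (x - y)"
  have t: "0 < t" "t < d / 2" "t < 1" using False y d_small by (auto simp: t_def)
  have "norm (x - (2 *\<^sub>R x - y)) = t" by (simp add: t_def scaleR_2 norm_minus_commute)
  then have "H x y + H x (2 *\<^sub>R x - y) = (F x (x + (y - x)) + F x (x - (y - x))) / t powr q"
    by (simp add: H_def t_def[symmetric] add_divide_distrib scaleR_2 algebra_simps)
  also have "\<dots> \<le> B1 * d * (t powr p / t powr q)"
    unfolding times_divide_eq_right
    using inner_pair_le[of "y - x"] y
    by (intro divide_right_mono) (auto simp: t_def norm_minus_commute)
  also have "t powr p / t powr q = t powr (p * (1 - s)) * t powr (- real CARD('n))"
    by (simp add: q_def powr_diff[symmetric] powr_add[symmetric] algebra_simps)
  also have "B1 * d * (t powr (p * (1 - s)) * t powr (- real CARD('n)))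
      \<le> B1 * d * (t powr (k0 + k0) * t powr (- real CARD('n)))"
    using t d k0 B_nonneg by (intro mult_left_mono mult_right_mono powr_mono') auto
  also have "\<dots> = B1 * d * t powr k0 * t powr (k0 - real CARD('n))"
    unfolding mult.assoc powr_add[symmetric] by simp
  also have "\<dots> \<le> B1 * d * (d / 2) powr k0 * t powr (k0 - real CARD('n))"
    using t d k0 B_nonneg by (intro mult_left_mono mult_right_mono powr_mono2) auto
  finally show ?thesis by (simp add: t_def)
qed

text \<open>
  A step of length \<open>O(d^3)\<close> between arguments of size \<open>O(t)\<close>, at distance \<open>t \<ge> d / 2\<close> from
  \<open>x\<close>: the part \<open>t^(k0 - 2)\<close> of the singularity is paid for by \<open>d\<close>, leaving an integrable weight
  and, since \<open>d^3 (d / 2)^(k0 - 2) = 4 d (d / 2)^k0\<close>, a total of higher order than \<open>d\<close>.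
\<close>
lemma near_increment_le:
  assumes ab: "a \<le> b" "\<bar>a\<bar> \<le> 2 * L * t" "\<bar>b\<bar> \<le> 2 * L * t" "b - a \<le> 9 * (L * d ^ 3)"
    and t: "d / 2 \<le> t" "t \<le> 1"
  shows "(ppow p b - ppow p a) / t powr q
    \<le> B2 * d ^ 3 * (d / 2) powr (k0 - 2) * t powr (k0 - real CARD('n))"
proof -
  have t0: "0 < t" using t d by simp
  have "ppow p b - ppow p a \<le> (p - 1) * (2 * L * t) powr (p - 2) * (b - a)"
    using ab p by (intro ppow_diff_le) auto
  also have "\<dots> \<le> (p - 1) * (2 * L * t) powr (p - 2) * (9 * (L * d ^ 3))"
    using ab p by (intro mult_left_mono) auto
  also have "\<dots> = B2 * d ^ 3 * t powr (p - 2)"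
    using L_nonneg t0 by (simp add: B2_def powr_mult)
  finally have "(ppow p b - ppow p a) / t powr q \<le> B2 * d ^ 3 * (t powr (p - 2) / t powr q)"
    unfolding times_divide_eq_right by (intro divide_right_mono) auto
  also have "t powr (p - 2) / t powr q = t powr (p * (1 - s)) * t powr (- 2 - real CARD('n))"
    by (simp add: q_def powr_diff[symmetric] powr_add[symmetric] algebra_simps)
  also have "B2 * d ^ 3 * (t powr (p * (1 - s)) * t powr (- 2 - real CARD('n)))
      \<le> B2 * d ^ 3 * (t powr (k0 + k0) * t powr (- 2 - real CARD('n)))"
    using t d t0 k0 B_nonneg by (intro mult_left_mono mult_right_mono powr_mono') auto
  also have "\<dots> = B2 * d ^ 3 * (t powr (k0 - 2) * t powr (k0 - real CARD('n)))"
    by (simp add: powr_add[symmetric])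
  also have "\<dots> \<le> B2 * d ^ 3 * ((d / 2) powr (k0 - 2) * t powr (k0 - real CARD('n)))"
    using t d k0 B_nonneg by (intro mult_left_mono mult_right_mono powr_mono2') auto
  finally show ?thesis by (simp add: ac_simps)
qed

text \<open>
  The two summands serve the points of \<open>ball x0 R\<close>, which lies in \<open>ball x 1\<close>, and the points outside it; each
  is kept everywhere so that integrability and nonnegativity are immediate.
\<close>
definition majorant :: "real ^ 'n \<Rightarrow> real" where
  "majorant y = indicator (ball x 1) y *
       (B2 * d ^ 3 * (d / 2) powr (k0 - 2) * norm (x - y) powr (k0 - real CARD('n)))
     + B3 * d ^ 3 * ((1 + \<bar>u y\<bar> powr (p - 1)) / (1 + norm y powr q))"

lemma majorant_near:
  assumes "norm (x - y) < 1"
  shows "B2 * d ^ 3 * (d / 2) powr (k0 - 2) * norm (x - y) powr (k0 - real CARD('n)) \<le> majorant y"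
  using assms B_nonneg d by (auto simp: majorant_def dist_norm intro!: mult_nonneg_nonneg divide_nonneg_nonneg add_nonneg_nonneg)

lemma majorant_far: "B3 * d ^ 3 * ((1 + \<bar>u y\<bar> powr (p - 1)) / (1 + norm y powr q)) \<le> majorant y"
  using B_nonneg d by (auto simp: majorant_def intro!: mult_nonneg_nonneg)

lemma majorant_nonneg: "0 \<le> majorant y"
  by (rule order.trans[OF _ majorant_far]) (use B_nonneg d in \<open>auto intro!: mult_nonneg_nonneg divide_nonneg_nonneg add_nonneg_nonneg\<close>)

lemma P_nonneg: "0 \<le> P x b"
  using w_x(1) p ppow_mono[of p "u x - b" "ul x - b"] by (simp add: P_def w_ul)

lemma norm_diff_ball_less_1: "y \<in> ball x0 R \<Longrightarrow> norm (x - y) < 1"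
  using norm_triangle_ineq[of "x - x0" "x0 - y"] norm_x R d_small by (simp add: dist_norm)

lemma w_x_le: "w x \<le> L * (d / 2)" "w x \<le> L * d"
proof -
  have "d ^ 3 \<le> d * (1 / 2)"
    using mult_mono[of d "1/2" d 1] d d_small by (simp add: power3_eq_cube mult_left_mono)
  then have "L * d ^ 3 \<le> L * (d / 2)" using L_nonneg by (intro mult_left_mono) auto
  then show "w x \<le> L * (d / 2)" using w_x by simp
  also have "\<dots> \<le> L * d" using L_nonneg d by (intro mult_left_mono) auto
  finally show "w x \<le> L * d" .
qed

text \<open>
  On \<open>ball x0 R\<close> the Lipschitz bound for \<open>u\<close> makes the arguments of \<open>ppow\<close> comparable to the distance. Outside, only
  the growth of \<open>u\<close> is known: the derivative of \<open>ppow p\<close> has order \<open>\<bar>u y\<bar>^(p - 2)\<close>, which is absorbed by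
  \<open>1 + \<bar>u y\<bar>^(p - 1)\<close>.
\<close>
lemma outer_P_le:
  assumes y: "d / 2 \<le> norm (x - y)"
  shows "P x (u y) / norm (x - y) powr q \<le> majorant y"
proof (cases "y \<in> ball x0 R")
  case True
  define t where "t = norm (x - y)"
  have t: "d / 2 \<le> t" "t < 1" using y norm_diff_ball_less_1[OF True] by (auto simp: t_def)
  have uu: "\<bar>u x - u y\<bar> \<le> L * t" using u.lipschitz[OF x_in_ball True] by (simp add: t_def)
  have "L * (d / 2) \<le> L * t" using t L_nonneg by (intro mult_left_mono) auto
  then have "0 \<le> w x" "w x \<le> L * t" using w_x_le w_x by auto
  moreover have "0 \<le> L * d ^ 3" using L_nonneg d by simp
  ultimately have "(ppow p (ul x - u y) - ppow p (u x - u y)) / t powr q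
     \<le> B2 * d ^ 3 * (d / 2) powr (k0 - 2) * t powr (k0 - real CARD('n))"
    using uu w_x t by (intro near_increment_le) (auto simp: w_ul)
  also have "\<dots> \<le> majorant y" using majorant_near[of y] t by (simp add: t_def)
  finally show ?thesis by (simp add: P_def t_def)
next
  case False
  define t where "t = norm (x - y)"
  define v where "v = \<bar>u y\<bar>"
  have "R \<le> norm (x0 - y)" using False by (simp add: dist_norm)
  then have tR: "R / 2 \<le> t"
    using norm_triangle_ineq[of "x0 - x" "x - y"] norm_x d by (simp add: t_def norm_minus_commute)
  have t0: "0 < t" using tR R by simp
  have U: "\<bar>u z\<bar> \<le> u_bound" if "z \<in> ball x0 R" for z
  proof -
    have "\<bar>u z - u x0\<bar> \<le> L * norm (z - x0)" using that R by (intro u.lipschitz) auto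
    also have "\<dots> \<le> L * 1" using that R L_nonneg by (intro mult_left_mono) (auto simp: dist_norm norm_minus_commute)
    finally show ?thesis by (simp add: u_bound_def)
  qed
  have U': "\<bar>u x\<bar> \<le> u_bound" "\<bar>ul x\<bar> \<le> u_bound"
    using U x_in_ball reflect_in_ball[OF x0] by (auto simp: ul_def)
  have growth: "(u_bound + v) powr (p - 2) \<le> (2 * (1 + u_bound)) powr (p - 1) * (1 + v powr (p - 1))"
  proof -
    have v: "0 \<le> v" by (simp add: v_def)
    have "(u_bound + v) powr (p - 2) \<le> (1 + u_bound + v) powr (p - 2)"
      using p v B_nonneg by (intro powr_mono2) auto
    also have "\<dots> \<le> (1 + u_bound + v) powr (p - 1)" using p v B_nonneg by (intro powr_mono) auto
    also have "\<dots> \<le> (2 * (1 + u_bound) * max 1 v) powr (p - 1)"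
    proof (intro powr_mono2)
      define m where "m = (1 + u_bound) * max 1 v"
      have "1 * v \<le> m" "(1 + u_bound) * 1 \<le> m"
        unfolding m_def using B_nonneg v by (intro mult_mono mult_left_mono; simp)+
      then have "1 + u_bound + v \<le> 2 * m" by simp
      then show "1 + u_bound + v \<le> 2 * (1 + u_bound) * max 1 v" by (simp only: m_def mult.assoc)
    qed (use p v B_nonneg in auto)
    also have "\<dots> = (2 * (1 + u_bound)) powr (p - 1) * max 1 v powr (p - 1)"
      by (rule powr_mult)
    also have "\<dots> \<le> (2 * (1 + u_bound)) powr (p - 1) * (1 + v powr (p - 1))"
      by (intro mult_left_mono) (auto simp: max_def)
    finally show ?thesis .
  qed
  have "P x (u y) \<le> (p - 1) * (u_bound + v) powr (p - 2) * ((ul x - u y) - (u x - u y))"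
    unfolding P_def v_def using p U' w_x by (intro ppow_diff_le) (auto simp: w_ul)
  also have "\<dots> \<le> (p - 1) * ((2 * (1 + u_bound)) powr (p - 1) * (1 + v powr (p - 1))) * (L * d ^ 3)"
    using p growth w_x by (intro mult_mono) (auto simp: w_ul)
  finally have PU: "P x (u y) \<le> (p - 1) * ((2 * (1 + u_bound)) powr (p - 1) * (1 + v powr (p - 1))) * (L * d ^ 3)" .
  have kernel: "1 / t powr q \<le> 2 * far_ratio powr q / (1 + norm y powr q)"
  proof -
    have L1: "2 / R \<le> far_ratio" and ratio_pos: "0 < far_ratio"
      using R mult_right_mono[of 1 "norm x0 + 1" "2 / R"] by (auto simp: far_ratio_def intro!: add_nonneg_pos)
    have one: "1 \<le> (2 / R) * t" using tR R by (simp add: field_simps)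
    have "(2 / R) * t \<le> far_ratio * t" using L1 t0 by (intro mult_right_mono) auto
    then have "1 \<le> far_ratio * t" using one by linarith
    then have A: "1 \<le> (far_ratio * t) powr q" using q by (intro ge_one_powr_ge_zero) auto
    have "norm y \<le> norm x0 + d + t"
      using norm_triangle_ineq[of x0 "x - x0"] norm_triangle_ineq[of x "y - x"] norm_x
      by (simp add: t_def norm_minus_commute)
    also have "\<dots> \<le> (norm x0 + 1) * 1 + t" using d_small by simp
    also have "\<dots> \<le> (norm x0 + 1) * ((2 / R) * t) + t"
      using one by (intro add_mono mult_left_mono) auto
    also have "\<dots> = far_ratio * t" by (simp add: far_ratio_def algebra_simps)
    finally have "norm y powr q \<le> (far_ratio * t) powr q" using q by (intro powr_mono2) auto
    then have "1 + norm y powr q \<le> 2 * (far_ratio * t) powr q" using A by simp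
    also have "\<dots> = 2 * far_ratio powr q * t powr q" using ratio_pos t0 by (simp add: powr_mult)
    finally show ?thesis using t0 by (simp add: divide_simps add_pos_nonneg mult.commute)
  qed
  have "P x (u y) / t powr q = P x (u y) * (1 / t powr q)" by simp
  also have "\<dots> \<le> ((p - 1) * ((2 * (1 + u_bound)) powr (p - 1) * (1 + v powr (p - 1))) * (L * d ^ 3)) *
      (2 * far_ratio powr q / (1 + norm y powr q))"
    using PU kernel P_nonneg d L_nonneg p
    by (intro mult_mono) (auto intro!: mult_nonneg_nonneg add_nonneg_nonneg)
  also have "\<dots> = B3 * d ^ 3 * ((1 + \<bar>u y\<bar> powr (p - 1)) / (1 + norm y powr q))"
    by (simp add: B3_def v_def)
  also have "\<dots> \<le> majorant y" by (rule majorant_far)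
  finally show ?thesis by (simp add: t_def)
qed

lemma norm_reflect_ge:
  assumes "l \<le> y $ e" shows "norm (x - y) \<le> norm (x - reflect e l y)"
proof -
  have "norm (x - y) ^ 2 \<le> norm (x - reflect e l y) ^ 2"
    unfolding norm_diff_reflect_power2 using assms d by (simp add: x_e)
  then show ?thesis by (rule power2_le_imp_le) simp
qed

lemma kernel_reflect_le:
  assumes "l \<le> y $ e" "y \<noteq> x"
  shows "1 / norm (x - reflect e l y) powr q \<le> 1 / norm (x - y) powr q"
proof -
  have "norm (x - y) powr q \<le> norm (x - reflect e l y) powr q"
    using q by (intro powr_mono2 norm_reflect_ge assms) auto
  moreover have "0 < norm (x - y) powr q" using assms by auto
  ultimately show ?thesis by (intro divide_left_mono mult_pos_pos) auto
qed

text \<open>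
  The identity behind the estimate outside the small ball: reflecting \<open>y\<close> exchanges \<open>u y\<close> and \<open>ul y\<close>, hence
  \<open>F x y + F x (reflect e l y) = P x (u y) + P x (ul y)\<close>. The terms with \<open>F x y\<close> and \<open>P x (u y)\<close> carry the
  sign information and are kept explicit.
\<close>
lemma outer_pair_le_gain:
  assumes y: "l \<le> y $ e" "d / 2 \<le> norm (x - y)"
  shows "H x y + H x (reflect e l y)
    \<le> F x y * (1 / norm (x - y) powr q - 1 / norm (x - reflect e l y) powr q) + majorant y + majorant (reflect e l y)
       - P x (u y) * (1 / norm (x - y) powr q - 1 / norm (x - reflect e l y) powr q)"
proof -
  define K1 where "K1 = 1 / norm (x - y) powr q"
  define K2 where "K2 = 1 / norm (x - reflect e l y) powr q"
  have "F x y + F x (reflect e l y) = P x (u y) + P x (ul y)"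
    by (simp add: F_def P_def u_reflect)
  then have FF: "F x (reflect e l y) = P x (u y) + P x (ul y) - F x y" by simp
  have "H x y + H x (reflect e l y) = F x y * K1 + F x (reflect e l y) * K2"
    by (simp add: H_def K1_def K2_def)
  also have "\<dots> = F x y * (K1 - K2) + P x (u y) * K1 + P x (ul y) * K2 - P x (u y) * (K1 - K2)"
    unfolding FF by (simp add: algebra_simps)
  also have "P x (u y) * K1 \<le> majorant y" using outer_P_le[OF y(2)] by (simp add: K1_def)
  also have "P x (ul y) * K2 \<le> majorant (reflect e l y)"
    using outer_P_le[of "reflect e l y"] norm_reflect_ge[OF y(1)] y(2) by (simp add: K2_def u_reflect)
  finally show ?thesis by (simp add: K1_def K2_def)
qed

lemma F_le_P:
  assumes "l \<le> y $ e" shows "F x y \<le> P x (u y)"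
  using ppow_mono[of p "ul x - ul y" "ul x - u y"] w_nonneg[OF assms] p by (simp add: F_def P_def w_ul)

lemma outer_pair_le:
  assumes y: "l \<le> y $ e" "d / 2 \<le> norm (x - y)"
  shows "H x y + H x (reflect e l y) \<le> majorant y + majorant (reflect e l y)"
proof -
  have "y \<noteq> x" using y d by auto
  then have "F x y * (1 / norm (x - y) powr q - 1 / norm (x - reflect e l y) powr q)
     \<le> P x (u y) * (1 / norm (x - y) powr q - 1 / norm (x - reflect e l y) powr q)"
    using F_le_P[OF y(1)] kernel_reflect_le[OF y(1)] by (intro mult_right_mono) auto
  then show ?thesis using outer_pair_le_gain[OF y] by linarith
qed

text \<open>
  The reflection of the small ball belongs to the outer region but its points have lost their partners,
  which lie inside. There is no singularity on it, and both \<open>w x\<close> and \<open>w y\<close> are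
  \<open>O(d^3)\<close>, so the crude bound suffices.
\<close>
lemma reflected_inner_le:
  assumes y: "norm (x - y) < d / 2"
  shows "H x (reflect e l y) \<le> majorant (reflect e l y)"
proof -
  define t where "t = norm (x - reflect e l y)"
  have ball: "y \<in> ball x0 R" using y d by (intro near_in_ball) (simp add: norm_minus_commute)
  have "\<bar>(x - y) $ e\<bar> \<le> norm (x - y)" by (rule component_le_norm_cart)
  then have ye: "l < y $ e" using y by (simp add: x_e abs_if split: if_splits)
  have "d \<le> t"
  proof -
    have "\<bar>(x - reflect e l y) $ e\<bar> \<le> t" unfolding t_def by (rule component_le_norm_cart)
    then show ?thesis using ye by (simp add: reflect_component x_e)
  qed
  have t1: "t < 1"
    using norm_diff_ball_less_1 reflect_in_ball[OF x0] ball by (simp add: t_def)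
  have wy: "0 \<le> w y" using ye by (intro w_nonneg) simp
  have wy8: "w y \<le> 8 * (L * d ^ 3)"
  proof -
    have "norm (y - x0) \<le> 2 * d"
      using norm_triangle_ineq[of "y - x" "x - x0"] y norm_x d by (simp add: norm_minus_commute)
    then have "L * norm (y - x0) ^ 3 \<le> L * (2 * d) ^ 3"
      using L_nonneg by (intro mult_left_mono power_mono) auto
    then show ?thesis using w_cubic[OF ball] by (simp add: power_mult_distrib)
  qed
  have "8 * d ^ 3 \<le> d"
    using mult_mono[of "8 * d" 1 d 1] d d_small by (simp add: power3_eq_cube mult_left_mono)
  then have "L * (8 * d ^ 3) \<le> L * d" using L_nonneg by (intro mult_left_mono)
  then have wyd: "w y \<le> L * d" using wy8 by simp
  have uu: "\<bar>u x - u y\<bar> \<le> L * (d / 2)"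
    using order.trans[OF u.lipschitz[OF x_in_ball ball] mult_left_mono[of _ "d / 2" L]] y L_nonneg by simp
  have Lt: "L * d \<le> L * t" using \<open>d \<le> t\<close> L_nonneg by (intro mult_left_mono)
  have "(ppow p (ul x - u y) - ppow p (u x - ul y)) / t powr q
     \<le> B2 * d ^ 3 * (d / 2) powr (k0 - 2) * t powr (k0 - real CARD('n))"
    using uu w_x w_x_le wy wy8 wyd Lt t1 \<open>d \<le> t\<close> d
    by (intro near_increment_le) (auto simp: w_ul abs_if split: if_splits)
  also have "\<dots> \<le> majorant (reflect e l y)" using majorant_near[of "reflect e l y"] t1 by (simp add: t_def)
  finally show ?thesis by (simp add: H_def F_def u_reflect t_def)
qed

end

end

section \<open>The operator difference near a flat boundary point\<close>

context hopf_contact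
begin

text \<open>
  The mean value theorem for \<open>t^(- q / 2)\<close> between the squared distances. All distances are below 1, so the
  modulus of the derivative is at least \<open>q / 2\<close>.
\<close>
lemma kernel_gap:
  assumes d: "0 < d" "8 * d < R" and x: "x = x0 + d *\<^sub>R axis e 1"
    and y: "l + 3 * R / 8 \<le> y $ e" "y \<in> ball x0 R" "y \<noteq> x"
  shows "3 * R * q / 4 * d \<le> 1 / norm (x - y) powr q - 1 / norm (x - reflect e l y) powr q"
proof -
  have powr_half: "1 / norm v powr q = (norm v ^ 2) powr (- q / 2)" if "v \<noteq> 0" for v :: "real ^ 'n"
  proof -
    have "norm v ^ 2 = norm v powr 2" by simp
    then have "(norm v ^ 2) powr (- q / 2) = (norm v powr 2) powr (- q / 2)" by (simp only:)
    also have "\<dots> = norm v powr (- q)" unfolding powr_powr by simp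
    finally show ?thesis by (simp only: powr_minus_divide)
  qed
  define A where "A = norm (x - y) ^ 2"
  define A' where "A' = norm (x - reflect e l y) ^ 2"
  have A': "A' = A + 4 * d * (y $ e - l)"
    unfolding A_def A'_def norm_diff_reflect_power2 by (simp add: x_e[OF d x])
  have A0: "0 < A" using y by (simp add: A_def)
  have step: "3 * R / 8 * (4 * d) \<le> A' - A"
  proof -
    have "(4 * d) * (3 * R / 8) \<le> (4 * d) * (y $ e - l)" using d y by (intro mult_left_mono) auto
    then show ?thesis by (simp add: A' mult.commute)
  qed
  moreover have "0 < 3 * R / 8 * (4 * d)" using R d by simp
  ultimately have AA': "A < A'" by linarith
  have "norm (x - reflect e l y) < 1"
    using norm_diff_ball_less_1[OF d x] reflect_in_ball[OF x0] y by simp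
  then have A'1: "A' \<le> 1" unfolding A'_def by (intro power_le_one) auto
  have "((\<lambda>t. t powr (- q / 2)) has_real_derivative (- q / 2) * t powr (- q / 2 - 1)) (at t)"
    if "A \<le> t" for t
    using that A0 by (intro has_real_derivative_powr) simp
  then obtain t where t: "A < t" "t < A'"
    "A' powr (- q / 2) - A powr (- q / 2) = (A' - A) * ((- q / 2) * t powr (- q / 2 - 1))"
    using MVT2[OF AA', of "\<lambda>t. t powr (- q / 2)" "\<lambda>t. (- q / 2) * t powr (- q / 2 - 1)"] by auto
  have "1 \<le> t powr (- q / 2 - 1)"
    using powr_mono2'[of "- q / 2 - 1" t 1] t A0 A'1 q by simp
  then have "3 * R / 8 * (4 * d) * (q / 2 * 1) \<le> (A' - A) * (q / 2 * t powr (- q / 2 - 1))"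
    using step q R d AA' by (intro mult_mono mult_left_mono) auto
  also have "\<dots> = A powr (- q / 2) - A' powr (- q / 2)" using t by simp
  also have "\<dots> = 1 / norm (x - y) powr q - 1 / norm (x - reflect e l y) powr q"
  proof -
    have ne: "x - y \<noteq> 0" "x - reflect e l y \<noteq> 0" using A0 AA' by (auto simp: A_def A'_def)
    show ?thesis unfolding A_def A'_def powr_half[OF ne(1)] powr_half[OF ne(2)] ..
  qed
  finally show ?thesis by (simp add: ac_simps)
qed

text \<open>
  A ball compactly inside both the half-space and \<open>ball x0 R\<close>, independent of \<open>d\<close>.
\<close>
definition gain_ball :: "(real ^ 'n) set" where
  "gain_ball = ball (x0 + (R / 2) *\<^sub>R axis e 1) (R / 8)"

lemma gain_ball_facts:
  assumes y: "y \<in> cball (x0 + (R / 2) *\<^sub>R axis e 1) (R / 8)"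
  shows "l + 3 * R / 8 \<le> y $ e" "y \<in> ball x0 R"
proof -
  let ?c = "x0 + (R / 2) *\<^sub>R axis e 1"
  have "\<bar>(?c - y) $ e\<bar> \<le> norm (?c - y)" by (rule component_le_norm_cart)
  also have "\<dots> \<le> R / 8" using y by (simp add: dist_norm)
  finally show "l + 3 * R / 8 \<le> y $ e" by (simp add: x0 abs_if split: if_splits)
  have "norm (x0 - y) \<le> norm (x0 - ?c) + norm (?c - y)"
    using norm_triangle_ineq[of "x0 - ?c" "?c - y"] by simp
  also have "\<dots> \<le> R / 2 + R / 8" using y R by (intro add_mono) (auto simp: dist_norm)
  finally show "y \<in> ball x0 R" using R by (simp add: dist_norm)
qed

lemma ex_gain: "\<exists>m>0. \<forall>y\<in>gain_ball. m \<le> w y"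
proof -
  let ?K = "cball (x0 + (R / 2) *\<^sub>R axis e 1) (R / 8)"
  have "continuous_on ?K w"
    using gain_ball_facts w.gradient by (intro continuous_at_imp_continuous_on) (blast intro: GDERIV_imp_isCont)
  then obtain y0 where y0: "y0 \<in> ?K" "\<And>y. y \<in> ?K \<Longrightarrow> w y0 \<le> w y"
    using continuous_attains_inf[of ?K w] R by auto
  have "0 < w y0" using gain_ball_facts(1)[OF y0(1)] R by (intro w_pos) simp
  then show ?thesis using y0(2) by (intro exI[of _ "w y0"]) (auto simp: gain_ball_def)
qed

text \<open>
  \<open>P x (u y) - F x y\<close> is the increment of \<open>ppow p\<close> over a step of length \<open>w y \<ge> m\<close>, bounded below wherever
  it starts; \<open>kernel_gap\<close> contributes the factor \<open>d\<close>.
\<close>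
lemma gain_pair_le:
  assumes d: "0 < d" "8 * d < R" and x: "x = x0 + d *\<^sub>R axis e 1"
    and y: "y \<in> gain_ball" and m: "0 < m" "m \<le> w y"
  shows "d / 2 \<le> norm (x - y)"
    and "H x y + H x (reflect e l y)
      \<le> majorant d x y + majorant d x (reflect e l y) - ppow p (m / 2) * (3 * R * q / 4) * d"
proof -
  have ye: "l + 3 * R / 8 \<le> y $ e" and ball: "y \<in> ball x0 R"
    using gain_ball_facts[of y] y by (auto simp: gain_ball_def)
  have "\<bar>(x - y) $ e\<bar> \<le> norm (x - y)" by (rule component_le_norm_cart)
  then show far: "d / 2 \<le> norm (x - y)" using ye d by (simp add: x_e[OF d x] abs_if split: if_splits)
  then have ne: "y \<noteq> x" using d by auto
  define G where "G = 1 / norm (x - y) powr q - 1 / norm (x - reflect e l y) powr q"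
  have G: "3 * R * q / 4 * d \<le> G" unfolding G_def by (rule kernel_gap[OF d x ye ball ne])
  have "ppow p (m / 2) \<le> ppow p (w y / 2)" using m p by (intro ppow_mono) auto
  also have "\<dots> \<le> ppow p (ul x - u y) - ppow p (ul x - u y - w y)"
    using m p by (intro ppow_gap) auto
  also have "\<dots> = P x (u y) - F x y" by (simp add: P_def F_def w_ul)
  finally have PF: "ppow p (m / 2) \<le> P x (u y) - F x y" .
  moreover have "0 \<le> ppow p (m / 2)" using m by (simp add: ppow_def)
  ultimately have "ppow p (m / 2) * (3 * R * q / 4 * d) \<le> (P x (u y) - F x y) * G"
    using G q R d by (intro mult_mono) auto
  moreover have "H x y + H x (reflect e l y)
      \<le> F x y * G + majorant d x y + majorant d x (reflect e l y) - P x (u y) * G"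
    unfolding G_def using ye R far by (intro outer_pair_le_gain[OF d x]) auto
  ultimately show "H x y + H x (reflect e l y)
      \<le> majorant d x y + majorant d x (reflect e l y) - ppow p (m / 2) * (3 * R * q / 4) * d"
    by (simp add: left_diff_distrib)
qed

definition near_mass :: real where
  "near_mass = (LINT z|lebesgue. indicator (ball 0 1) (z :: real ^ 'n) * norm z powr (k0 - real CARD('n)))"

definition far_mass :: real where
  "far_mass = (LINT y|lebesgue. (1 + \<bar>u y\<bar> powr (p - 1)) / (1 + norm y powr q))"

lemma near_mass_nonneg: "0 \<le> near_mass" unfolding near_mass_def by (rule Bochner_Integration.integral_nonneg) auto

lemma far_mass_nonneg: "0 \<le> far_mass" unfolding far_mass_def by (rule Bochner_Integration.integral_nonneg) auto

lemma near_weight: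
  fixes x :: "real ^ 'n"
  shows "integrable lebesgue (\<lambda>y. indicator (ball x 1) y * norm (x - y) powr (k0 - real CARD('n)))"
    and "(LINT y|lebesgue. indicator (ball x 1) y * norm (x - y) powr (k0 - real CARD('n))) = near_mass"
proof -
  let ?h = "\<lambda>z :: real ^ 'n. indicator (ball 0 1) z * norm z powr (k0 - real CARD('n))"
  have "1 \<le> real CARD('n)" using zero_less_card_finite[where 'a = 'n] by (simp add: Suc_le_eq)
  then have "k0 \<le> real CARD('n)" using k0 by linarith
  then have h: "integrable lebesgue ?h"
    using integrable_norm_powr_unit_ball[of k0, where 'a = "real ^ 'n"] k0 by simp
  have eq: "?h (x - y) = indicator (ball x 1) y * norm (x - y) powr (k0 - real CARD('n))" for y
    unfolding indicator_def mem_ball_0 by (simp add: dist_norm)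
  show "integrable lebesgue (\<lambda>y. indicator (ball x 1) y * norm (x - y) powr (k0 - real CARD('n)))"
    "(LINT y|lebesgue. indicator (ball x 1) y * norm (x - y) powr (k0 - real CARD('n))) = near_mass"
    using integral_point_reflection[OF h, of x] unfolding eq near_mass_def by auto
qed

lemma far_weight:
  assumes "u \<in> L_sp s p"
  shows "integrable lebesgue (\<lambda>y. (1 + \<bar>u y\<bar> powr (p - 1)) / (1 + norm y powr q))"
proof -
  have "integrable lebesgue (\<lambda>y. 1 / (1 + norm (y :: real ^ 'n) powr q))"
    using q by (intro integrable_inverse_one_plus_norm_powr) simp
  moreover have "integrable lebesgue (\<lambda>y. \<bar>u y\<bar> powr (p - 1) / (1 + norm y powr q))"
    using assms by (simp add: L_sp_def q_def mult.commute)
  ultimately show ?thesis unfolding add_divide_distrib by (rule Bochner_Integration.integrable_add)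
qed

text \<open>
  The annulus between \<open>\<epsilon>\<close> and \<open>d / 2\<close> is integrated by pairing with respect to \<open>x\<close>, uniformly in
  \<open>\<epsilon>\<close>, and the outer region by pairing with respect to the hyperplane. All positive contributions have order
  \<open>d^(1 + k0)\<close> or \<open>d^3\<close>.
\<close>
lemma nonlocal_upper_bound:
  assumes usp: "u \<in> L_sp s p"
  obtains c1 B where "0 < c1"
    "\<And>d x v. 0 < d \<Longrightarrow> 8 * d < R \<Longrightarrow> x = x0 + d *\<^sub>R axis e 1 \<Longrightarrow>
       (\<And>\<epsilon>. 0 < \<epsilon> \<Longrightarrow> set_integrable lebesgue (- ball x \<epsilon>) (H x)) \<Longrightarrow>
       ((\<lambda>\<epsilon>. LINT y:- ball x \<epsilon>|lebesgue. H x y) \<longlongrightarrow> v) (at_right 0) \<Longrightarrow>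
       v \<le> (B * ((d / 2) powr k0 + d ^ 2) - c1) * d"
proof -
  obtain m where m: "0 < m" "\<And>y. y \<in> gain_ball \<Longrightarrow> m \<le> w y" using ex_gain by blast
  define c0 where "c0 = ppow p (m / 2) * (3 * R * q / 4)"
  have c0: "0 < c0" using m R q by (simp add: c0_def ppow_def)
  define c1 where "c1 = c0 * measure lebesgue gain_ball"
  define B where "B = (B1 + 4 * B2) * near_mass + B3 * far_mass"
  have "0 < c1" using c0 R by (simp add: c1_def gain_ball_def)
  moreover have "v \<le> (B * ((d / 2) powr k0 + d ^ 2) - c1) * d"
    if d: "0 < d" "8 * d < R" and x: "x = x0 + d *\<^sub>R axis e 1"
      and int: "\<And>\<epsilon>. 0 < \<epsilon> \<Longrightarrow> set_integrable lebesgue (- ball x \<epsilon>) (H x)"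
      and lim: "((\<lambda>\<epsilon>. LINT y:- ball x \<epsilon>|lebesgue. H x y) \<longlongrightarrow> v) (at_right 0)" for d x v
  proof -
    let ?r = "d / 2"
    let ?J = "\<lambda>y. indicator (ball x 1) y * norm (x - y) powr (k0 - real CARD('n))"
    define A where "A = B1 * d * ?r powr k0"
    have A: "0 \<le> A" using B_nonneg d by (simp add: A_def)
    have r1: "?r < 1" using d R by simp
    have inner: "(LINT y|lebesgue. indicator (ball x ?r - ball x \<epsilon>) y * H x y) \<le> A * near_mass"
      if \<epsilon>: "0 < \<epsilon>" "\<epsilon> < ?r" for \<epsilon>
    proof -
      define S where "S = ball x ?r - ball x \<epsilon>"
      have sym: "2 *\<^sub>R x - y \<in> S \<longleftrightarrow> y \<in> S" for y
        by (simp add: S_def dist_norm scaleR_2 norm_minus_commute)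
      have "set_integrable lebesgue S (H x)"
        by (rule set_integrable_subset[OF int[OF \<epsilon>(1)]]) (auto simp: S_def)
      then have fi: "integrable lebesgue (\<lambda>y. indicator S y * H x y)" by (simp add: set_integrable_def)
      have gi: "integrable lebesgue (\<lambda>y. A * ?J y)" using near_weight(1) by (intro integrable_mult_right)
      have "(LINT y|lebesgue. indicator S y * H x y) \<le> (LINT y|lebesgue. A * ?J y)"
      proof (rule integral_mono_symmetrized[OF lebesgue_distr_point_reflection[of x] fi gi])
        fix y
        have J0: "0 \<le> A * ?J z" for z using A by auto
        show "indicator S y * H x y + indicator S (2 *\<^sub>R x - y) * H x (2 *\<^sub>R x - y)
            \<le> A * ?J y + A * ?J (2 *\<^sub>R x - y)"
        proof (cases "y \<in> S")
          case True
          then have "norm (x - y) < ?r" by (simp add: S_def dist_norm)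
          then have "H x y + H x (2 *\<^sub>R x - y) \<le> A * ?J y"
            using inner_kernel_pair_le[OF d x, of y] r1 by (simp add: A_def dist_norm)
          then show ?thesis using True sym[of y] J0[of "2 *\<^sub>R x - y"] by simp
        next
          case False
          then show ?thesis using sym[of y] J0[of y] J0[of "2 *\<^sub>R x - y"] by simp
        qed
      qed
      also have "\<dots> = A * near_mass" by (simp only: integral_mult_right_zero near_weight(2))
      finally show ?thesis by (simp add: S_def)
    qed
    have outer: "(LINT y|lebesgue. indicator (- ball x ?r) y * H x y)
        \<le> B2 * d ^ 3 * ?r powr (k0 - 2) * near_mass + B3 * d ^ 3 * far_mass - c1 * d"
    proof -
      have fi: "integrable lebesgue (\<lambda>y. indicator (- ball x ?r) y * H x y)"
        using int[of ?r] d by (simp add: set_integrable_def)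
      have majorant_eq: "majorant d x y = B2 * d ^ 3 * ?r powr (k0 - 2) * ?J y
          + B3 * d ^ 3 * ((1 + \<bar>u y\<bar> powr (p - 1)) / (1 + norm y powr q))" for y
        by (simp add: majorant_def[OF d x])
      have Mi: "integrable lebesgue (majorant d x)"
        unfolding majorant_eq using near_weight(1)[of x] far_weight[OF usp]
        by (intro Bochner_Integration.integrable_add integrable_mult_right)
      have "(LINT y|lebesgue. majorant d x y) = (LINT y|lebesgue. B2 * d ^ 3 * ?r powr (k0 - 2) * ?J y)
          + (LINT y|lebesgue. B3 * d ^ 3 * ((1 + \<bar>u y\<bar> powr (p - 1)) / (1 + norm y powr q)))"
        unfolding majorant_eq using near_weight(1)[of x] far_weight[OF usp]
        by (intro Bochner_Integration.integral_add integrable_mult_right)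
      then have Mint: "(LINT y|lebesgue. majorant d x y)
          = B2 * d ^ 3 * ?r powr (k0 - 2) * near_mass + B3 * d ^ 3 * far_mass"
        by (simp only: integral_mult_right_zero near_weight(2) far_mass_def)
      have Di: "integrable lebesgue (\<lambda>y. c0 * d * indicator gain_ball y)"
        using R
        by (intro integrable_mult_right integrable_real_indicator) (simp_all add: gain_ball_def emeasure_ball)
      have gi: "integrable lebesgue (\<lambda>y. majorant d x y - c0 * d * indicator gain_ball y)"
        using Mi Di by (rule Bochner_Integration.integrable_diff)
      have half: "indicator (- ball x ?r) y * H x y + indicator (- ball x ?r) (reflect e l y) * H x (reflect e l y)
          \<le> (majorant d x y - c0 * d * indicator gain_ball y)
            + (majorant d x (reflect e l y) - c0 * d * indicator gain_ball (reflect e l y))" if y: "l \<le> y $ e" for y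
      proof -
        have "reflect e l y \<notin> gain_ball"
        proof
          assume "reflect e l y \<in> gain_ball"
          then have "l + 3 * R / 8 \<le> reflect e l y $ e" by (intro gain_ball_facts(1)) (simp add: gain_ball_def)
          then show False using y R by (simp add: reflect_component)
        qed
        moreover have "indicator (- ball x ?r) y * H x y + indicator (- ball x ?r) (reflect e l y) * H x (reflect e l y)
          \<le> majorant d x y - c0 * d * indicator gain_ball y + majorant d x (reflect e l y)"
        proof (cases "norm (x - y) < ?r")
          case True
          have "d / 2 \<le> norm (x - y)" if "y \<in> gain_ball"
            using gain_pair_le(1)[OF d x that m(1) m(2)[OF that]] .
          then have "y \<notin> gain_ball" using True by force
          moreover have "indicator (- ball x ?r) (reflect e l y) * H x (reflect e l y) \<le> majorant d x (reflect e l y)"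
            using reflected_inner_le[OF d x True] majorant_nonneg[OF d x, of "reflect e l y"]
            by (simp add: indicator_def)
          ultimately show ?thesis using True majorant_nonneg[OF d x, of y] by (simp add: dist_norm)
        next
          case False
          then have far: "y \<notin> ball x ?r" "reflect e l y \<notin> ball x ?r"
            using norm_reflect_ge[OF d x y] by (auto simp: dist_norm)
          show ?thesis
          proof (cases "y \<in> gain_ball")
            case True
            then show ?thesis
              using gain_pair_le(2)[OF d x True m(1) m(2)[OF True]] far by (simp add: c0_def)
          next
            case notD: False
            then show ?thesis using outer_pair_le[OF d x y] False far by simp
          qed
        qed
        ultimately show ?thesis by simp
      qed
      have "(LINT y|lebesgue. indicator (- ball x ?r) y * H x y)
          \<le> (LINT y|lebesgue. majorant d x y - c0 * d * indicator gain_ball y)"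
      proof (rule integral_mono_symmetrized[OF lebesgue_distr_reflect[of e l] fi gi])
        fix y
        show "indicator (- ball x ?r) y * H x y + indicator (- ball x ?r) (reflect e l y) * H x (reflect e l y)
          \<le> (majorant d x y - c0 * d * indicator gain_ball y)
            + (majorant d x (reflect e l y) - c0 * d * indicator gain_ball (reflect e l y))"
          \<comment> \<open>The pairing is symmetric, so one of the two closed half-spaces is enough.\<close>
          using half[of y] half[of "reflect e l y"]
          by (cases "l \<le> y $ e") (simp_all add: reflect_component add.commute)
      qed
      also have "\<dots> = (LINT y|lebesgue. majorant d x y) - c1 * d"
        using Mi Di by (subst Bochner_Integration.integral_diff) (auto simp: c1_def gain_ball_def)
      finally show ?thesis unfolding Mint by simp
    qed
    have bound: "(LINT y:- ball x \<epsilon>|lebesgue. H x y) \<le> (B * (?r powr k0 + d ^ 2) - c1) * d"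
      if \<epsilon>: "0 < \<epsilon>" "\<epsilon> < ?r" for \<epsilon>
    proof -
      let ?S = "ball x ?r - ball x \<epsilon>"
      have fi: "integrable lebesgue (\<lambda>y. indicator (- ball x ?r) y * H x y)"
        using int[of ?r] d by (simp add: set_integrable_def)
      have "set_integrable lebesgue ?S (H x)"
        by (rule set_integrable_subset[OF int[OF \<epsilon>(1)]]) auto
      then have Si: "integrable lebesgue (\<lambda>y. indicator ?S y * H x y)" by (simp add: set_integrable_def)
      have "(LINT y:- ball x \<epsilon>|lebesgue. H x y)
          = (LINT y|lebesgue. indicator ?S y * H x y + indicator (- ball x ?r) y * H x y)"
        unfolding set_lebesgue_integral_def
        by (intro Bochner_Integration.integral_cong) (use \<epsilon> in \<open>auto simp: indicator_def\<close>)
      also have "\<dots> = (LINT y|lebesgue. indicator ?S y * H x y)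
          + (LINT y|lebesgue. indicator (- ball x ?r) y * H x y)"
        using Si fi by (rule Bochner_Integration.integral_add)
      also have "\<dots> \<le> A * near_mass + (B2 * d ^ 3 * ?r powr (k0 - 2) * near_mass + B3 * d ^ 3 * far_mass - c1 * d)"
        using inner[OF \<epsilon>] outer by (rule add_mono)
      also have "\<dots> = ((B1 + 4 * B2) * near_mass * ?r powr k0 + B3 * far_mass * d ^ 2 - c1) * d"
      proof -
        have "?r powr (k0 - 2) = ?r powr k0 / ?r ^ 2"
          using d by (simp add: powr_diff flip: powr_numeral)
        then have "d ^ 3 * ?r powr (k0 - 2) = 4 * d * ?r powr k0"
          using d by (simp add: power2_eq_square power3_eq_cube)
        then have "B2 * d ^ 3 * ?r powr (k0 - 2) * near_mass = B2 * (4 * d * ?r powr k0) * near_mass" by simp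
        then show ?thesis by (simp add: A_def algebra_simps power2_eq_square power3_eq_cube)
      qed
      also have "\<dots> \<le> (B * (?r powr k0 + d ^ 2) - c1) * d"
      proof -
        have "0 \<le> (B1 + 4 * B2) * near_mass" "0 \<le> B3 * far_mass"
          using B_nonneg near_mass_nonneg far_mass_nonneg by auto
        then have "(B1 + 4 * B2) * near_mass \<le> B" "B3 * far_mass \<le> B" by (auto simp: B_def)
        then have "(B1 + 4 * B2) * near_mass * ?r powr k0 \<le> B * ?r powr k0" "B3 * far_mass * d ^ 2 \<le> B * d ^ 2"
          by (auto intro: mult_right_mono)
        then show ?thesis
          unfolding distrib_left using d by (intro mult_right_mono diff_right_mono add_mono) auto
      qed
      finally show ?thesis .
    qed
    have "\<forall>\<^sub>F \<epsilon> in at_right 0. (LINT y:- ball x \<epsilon>|lebesgue. H x y) \<le> (B * (?r powr k0 + d ^ 2) - c1) * d"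
      using d bound by (auto simp: eventually_at_right_field intro!: exI[of _ ?r])
    then show ?thesis using lim by (intro tendsto_upperbound) auto
  qed
  ultimately show ?thesis by (rule that)
qed

end

section \<open>The half-space and its boundary\<close>

lemma infdist_hyperplane:
  fixes x :: "real ^ 'n"
  shows "infdist x {y. y $ e = l} = \<bar>x $ e - l\<bar>"
proof (rule antisym)
  let ?y = "x + (l - x $ e) *\<^sub>R axis e 1"
  have "infdist x {y. y $ e = l} \<le> dist x ?y" by (rule infdist_le) simp
  then show "infdist x {y. y $ e = l} \<le> \<bar>x $ e - l\<bar>"
    by (simp add: dist_norm abs_minus_commute)
  have "\<bar>x $ e - l\<bar> \<le> dist x y" if "y $ e = l" for y
    using component_le_norm_cart[of "x - y" e] that by (simp add: dist_norm)
  moreover have "?y \<in> {y. y $ e = l}" by simp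
  then have ne: "{y :: real ^ 'n. y $ e = l} \<noteq> {}" by blast
  ultimately show "\<bar>x $ e - l\<bar> \<le> infdist x {y. y $ e = l}"
    unfolding infdist_notempty[OF ne] by (intro cINF_greatest[OF ne]) simp
qed

lemma frontier_half_space: "frontier (half_space e l) = {x :: real ^ 'n. x $ e = l}"
proof -
  have "open {x :: real ^ 'n. x $ e > l}" by (rule open_halfspace_component_gt_cart)
  then show ?thesis by (auto simp: half_space_def frontier_def interior_open)
qed

text \<open>
  The argument approaches \<open>x0\<close> along the inner normal; this carries the decay hypothesis on \<open>c\<close> over to that
  path.
\<close>
lemma filterlim_normal_approach:
  assumes x0: "x0 $ e = l"
  shows "filterlim (\<lambda>d. x0 + d *\<^sub>R axis e 1) (approach_boundary (half_space e l)) (at_right 0)"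
  unfolding approach_boundary_def filterlim_inf
proof (rule conjI)
  have "((\<lambda>d::real. \<bar>d\<bar>) \<longlongrightarrow> \<bar>0\<bar>) (at_right 0)" by (intro tendsto_intros)
  then show "LIM d at_right 0. x0 + d *\<^sub>R axis e 1 :>
      filtercomap (\<lambda>x. infdist x (frontier (half_space e l))) (nhds 0)"
    unfolding filterlim_filtercomap_iff o_def frontier_half_space infdist_hyperplane by (simp add: x0)
  show "LIM d at_right 0. x0 + d *\<^sub>R axis e 1 :> principal (half_space e l)"
    unfolding filterlim_principal using eventually_at_right_less[of 0]
    by eventually_elim (simp add: half_space_def x0)
qed

lemma has_frac_p_laplacian_diff:
  assumes C: "C > 0" and a: "has_frac_p_laplacian C s p f x a" and b: "has_frac_p_laplacian C s p g x b"
  shows "\<And>\<epsilon>. 0 < \<epsilon> \<Longrightarrow> set_integrable lebesgue (- ball x \<epsilon>)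
           (\<lambda>y. plap_integrand s p f x y - plap_integrand s p g x y)"
    and "((\<lambda>\<epsilon>. LINT y:- ball x \<epsilon>|lebesgue. plap_integrand s p f x y - plap_integrand s p g x y)
           \<longlongrightarrow> (a - b) / C) (at_right 0)"
proof -
  have int: "set_integrable lebesgue (- ball x \<epsilon>) (plap_integrand s p f x)"
    "set_integrable lebesgue (- ball x \<epsilon>) (plap_integrand s p g x)" if "0 < \<epsilon>" for \<epsilon>
    using a b that by (auto simp: has_frac_p_laplacian_def)
  show "\<And>\<epsilon>. 0 < \<epsilon> \<Longrightarrow> set_integrable lebesgue (- ball x \<epsilon>)
           (\<lambda>y. plap_integrand s p f x y - plap_integrand s p g x y)"
    by (rule set_integral_diff(1)) (rule int, assumption)+
  have "((\<lambda>\<epsilon>. (C * (LINT y:- ball x \<epsilon>|lebesgue. plap_integrand s p f x y)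
      - C * (LINT y:- ball x \<epsilon>|lebesgue. plap_integrand s p g x y)) / C) \<longlongrightarrow> (a - b) / C) (at_right 0)"
    using a[unfolded has_frac_p_laplacian_def, THEN conjunct2]
      b[unfolded has_frac_p_laplacian_def, THEN conjunct2] C
    by (intro tendsto_divide tendsto_diff tendsto_const) simp_all
  moreover have "\<forall>\<^sub>F \<epsilon> in at_right 0. (C * (LINT y:- ball x \<epsilon>|lebesgue. plap_integrand s p f x y)
      - C * (LINT y:- ball x \<epsilon>|lebesgue. plap_integrand s p g x y)) / C
      = (LINT y:- ball x \<epsilon>|lebesgue. plap_integrand s p f x y - plap_integrand s p g x y)"
    using eventually_at_right_less[of 0]
  proof eventually_elim
    case (elim \<epsilon>)
    show ?case
      using C set_integral_diff(2)[OF int[OF elim]] by (simp add: right_diff_distrib[symmetric])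
  qed
  ultimately show "((\<lambda>\<epsilon>. LINT y:- ball x \<epsilon>|lebesgue. plap_integrand s p f x y - plap_integrand s p g x y)
           \<longlongrightarrow> (a - b) / C) (at_right 0)"
    by (rule Lim_transform_eventually)
qed

context hopf_contact
begin

lemma H_eq: "H x y = plap_integrand s p ul x y - plap_integrand s p u x y"
  by (simp add: H_def F_def ppow_def plap_integrand_def q_def diff_divide_distrib)

text \<open>
  After division by \<open>d\<close>, the equation and \<open>nonlocal_upper_bound\<close> bound the positive constant \<open>c1\<close> by a
  quantity that tends to zero with \<open>d\<close>; the zeroth-order term is controlled by \<open>w x \<le> L * d ^ 3\<close>.
\<close>
lemma contradiction_at_flat_contact:
  assumes usp: "u \<in> L_sp s p" and C: "0 < C"
    and eq: "\<And>x. l < x $ e \<Longrightarrow> \<exists>a b. has_frac_p_laplacian C s p (\<lambda>x. u (reflect e l x)) x a \<and>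
        has_frac_p_laplacian C s p u x b \<and> a - b + c x * w x = 0"
    and c: "((\<lambda>d. c (x0 + d *\<^sub>R axis e 1) * d ^ 2) \<longlongrightarrow> 0) (at_right 0)"
  shows False
proof -
  obtain c1 B where c1: "0 < c1" and bound:
    "\<And>d x v. 0 < d \<Longrightarrow> 8 * d < R \<Longrightarrow> x = x0 + d *\<^sub>R axis e 1 \<Longrightarrow>
       (\<And>\<epsilon>. 0 < \<epsilon> \<Longrightarrow> set_integrable lebesgue (- ball x \<epsilon>) (H x)) \<Longrightarrow>
       ((\<lambda>\<epsilon>. LINT y:- ball x \<epsilon>|lebesgue. H x y) \<longlongrightarrow> v) (at_right 0) \<Longrightarrow>
       v \<le> (B * ((d / 2) powr k0 + d ^ 2) - c1) * d"
    using nonlocal_upper_bound[OF usp] by blast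
  let ?pt = "\<lambda>d. x0 + d *\<^sub>R axis e 1"
  have le: "c1 \<le> B * ((d / 2) powr k0 + d ^ 2) + \<bar>c (?pt d) * d ^ 2\<bar> * (L / C)"
    if d: "0 < d" "8 * d < R" for d
  proof -
    define x where "x = ?pt d"
    have xe: "l < x $ e" using d by (simp add: x_def x0)
    obtain a b where ab: "has_frac_p_laplacian C s p ul x a" "has_frac_p_laplacian C s p u x b"
      "a - b + c x * w x = 0" using eq[OF xe] unfolding ul_def[symmetric] by blast
    have "(a - b) / C \<le> (B * ((d / 2) powr k0 + d ^ 2) - c1) * d"
      using has_frac_p_laplacian_diff[OF C ab(1,2)] unfolding H_eq[symmetric]
      by (intro bound[OF d x_def]) auto
    moreover have "a - b = - (c x * w x)" using ab(3) by simp
    moreover have "c x * w x / C \<le> \<bar>c x * d ^ 2\<bar> * (L / C) * d"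
    proof -
      have "c x * w x \<le> \<bar>c x\<bar> * w x" using w_x[OF d x_def] by (intro mult_right_mono) auto
      also have "\<dots> \<le> \<bar>c x\<bar> * (L * d ^ 3)" using w_x[OF d x_def] by (intro mult_left_mono) auto
      also have "\<dots> = \<bar>c x * d ^ 2\<bar> * L * d" using d by (simp add: abs_mult power2_eq_square power3_eq_cube)
      finally show ?thesis using C by (simp add: field_simps)
    qed
    ultimately have "c1 * d \<le> (B * ((d / 2) powr k0 + d ^ 2) + \<bar>c x * d ^ 2\<bar> * (L / C)) * d"
      by (simp add: algebra_simps)
    then show ?thesis using d by (simp add: x_def)
  qed
  have "((\<lambda>d. (d / 2) powr k0) \<longlongrightarrow> 0) (at_right 0)"
    using k0 by (intro tendsto_zero_powrI[of _ _ _ k0])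
      (auto intro!: tendsto_eq_intros simp: eventually_at_filter)
  moreover have "((\<lambda>d::real. d ^ 2) \<longlongrightarrow> 0) (at_right 0)" by (auto intro!: tendsto_eq_intros)
  ultimately have "((\<lambda>d. B * ((d / 2) powr k0 + d ^ 2) + \<bar>c (?pt d) * d ^ 2\<bar> * (L / C))
      \<longlongrightarrow> B * (0 + 0) + \<bar>0\<bar> * (L / C)) (at_right 0)"
    using c by (intro tendsto_intros)
  then have lim: "((\<lambda>d. B * ((d / 2) powr k0 + d ^ 2) + \<bar>c (?pt d) * d ^ 2\<bar> * (L / C)) \<longlongrightarrow> 0) (at_right 0)"
    by simp
  have "\<forall>\<^sub>F d in at_right 0. c1 \<le> B * ((d / 2) powr k0 + d ^ 2) + \<bar>c (?pt d) * d ^ 2\<bar> * (L / C)"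
    using R le by (auto simp: eventually_at_right_field intro!: exI[of _ "R / 8"])
  then have "c1 \<le> 0" using lim by (intro tendsto_lowerbound) auto
  then show False using c1 by simp
qed

end

theorem theorem1:
  fixes s p C l :: real
    and e :: "'n::finite"
    and \<Sigma> :: "(real ^ 'n) set"
    and u ul w c :: "real ^ 'n \<Rightarrow> real"
    and \<nu> :: "real ^ 'n"
  assumes s: "0 < s" "s < 1"
    and p: "p \<ge> 3"
    and C: "C > 0"
    and \<Sigma>: "\<Sigma> = half_space e l"
    and u: "u \<in> Ck_loc 3 (closure \<Sigma>)" "u \<in> L_sp s p"
    and ul: "ul = (\<lambda>x. u (reflect e l x))"
    and w: "w = (\<lambda>x. ul x - u x)"
    and equation: "\<forall>x\<in>\<Sigma>. \<exists>a b. has_frac_p_laplacian C s p ul x a \<and>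
                     has_frac_p_laplacian C s p u x b \<and> a - b + c x * w x = 0"
    and positive: "\<forall>x\<in>\<Sigma>. w x > 0"
    and antisymmetric: "\<forall>x\<in>\<Sigma>. w (reflect e l x) = - w x"
    and \<nu>: "\<nu> = - axis e 1"
    and c: "((\<lambda>x. c x * (infdist x (frontier \<Sigma>))\<^sup>2) \<longlongrightarrow> 0) (approach_boundary \<Sigma>)"
  shows "\<forall>x\<in>frontier \<Sigma>. \<exists>D. ((\<lambda>t. w (x + t *\<^sub>R \<nu>)) has_real_derivative D) (at 0) \<and> D < 0"
proof
  fix x0 assume x0F: "x0 \<in> frontier \<Sigma>"
  then have x0: "x0 $ e = l" by (simp add: \<Sigma> frontier_half_space)
  obtain U where U: "open U" "closure \<Sigma> \<subseteq> U" "Ck_on 3 u U" using u(1) by (auto simp: Ck_loc_def)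
  have "x0 \<in> U" using x0F U(2) by (auto simp: frontier_def)
  then obtain r where r: "0 < r" "cball x0 r \<subseteq> U" using U(1) open_contains_cball by blast
  define R where "R = min r (1 / 2)"
  have R: "0 < R" "R \<le> 1 / 2" "cball x0 R \<subseteq> U" using r by (auto simp: R_def)
  obtain gu Qu L where hu: "hessian_lipschitz (ball x0 R) u gu Qu L"
    by (rule Ck_on_3_imp_hessian_lipschitz[OF U(3) compact_cball convex_cball R(3) convex_ball
          ball_subset_cball])
  have L: "0 \<le> L" by (rule hessian_lipschitz.L_nonneg[OF hu])
  have hu2: "hessian_lipschitz (ball x0 R) u gu Qu (2 * L)"
    by (rule hessian_lipschitz_mono[OF hu]) (use L in simp)
  have sym: "reflect e l y \<in> ball x0 R" if "y \<in> ball x0 R" for y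
    using that by (simp only: reflect_in_ball[OF x0])
  define gw where "gw = (\<lambda>x. reflect e 0 (gu (reflect e l x)) - gu x)"
  define Qw where "Qw = (\<lambda>x z. Qu (reflect e l x) (reflect e 0 z) - Qu x z)"
  have hw: "hessian_lipschitz (ball x0 R) w gw Qw (2 * L)"
    unfolding w ul gw_def Qw_def using hu sym by (rule hessian_lipschitz_reflect_diff)
  have pos: "0 < w y" if "l < y $ e" for y using positive that by (simp add: \<Sigma> half_space_def)
  have zero: "w y = 0" if "y $ e = l" for y using that by (simp add: w ul reflect_fixed)
  have neg: "w y < 0" if "y $ e < l" for y
  proof -
    have "0 < w (reflect e l y)" using that by (intro pos) (simp add: reflect_component)
    then show ?thesis by (simp add: w ul)
  qed
  have D: "((\<lambda>t. w (x0 + t *\<^sub>R \<nu>)) has_real_derivative - gw x0 $ e) (at 0)"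
    using hessian_lipschitz.derivative_along[OF hw, of x0 0 \<nu>] R by (simp add: \<nu> inner_axis)
  have "0 < gw x0 $ e"
  proof (rule ccontr)
    assume "\<not> 0 < gw x0 $ e"
    then have "gw x0 $ e \<le> 0" by simp
    note flat = flat_at_contact[OF hw R(1) x0 less_imp_le[OF pos] zero less_imp_le[OF neg] this]
    interpret hopf_contact x0 R "2 * L" u w gu gw Qu Qw s p l e
      by (intro hopf_contact.intro hopf_contact_axioms.intro hu2 hw s p R(1,2) x0 pos flat)
        (simp_all add: w ul)
    have "((\<lambda>d. c (x0 + d *\<^sub>R axis e 1) * (infdist (x0 + d *\<^sub>R axis e 1) (frontier \<Sigma>))\<^sup>2) \<longlongrightarrow> 0) (at_right 0)"
      by (rule filterlim_compose[OF c]) (use filterlim_normal_approach[OF x0] in \<open>simp add: \<Sigma>\<close>)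
    then have "((\<lambda>d. c (x0 + d *\<^sub>R axis e 1) * d ^ 2) \<longlongrightarrow> 0) (at_right 0)"
      by (simp add: \<Sigma> frontier_half_space infdist_hyperplane x0)
    then show False
    proof (rule contradiction_at_flat_contact[OF u(2) C, rotated])
      fix x assume "l < x $ e"
      then have "x \<in> \<Sigma>" by (simp add: \<Sigma> half_space_def)
      then show "\<exists>a b. has_frac_p_laplacian C s p (\<lambda>x. u (reflect e l x)) x a \<and>
          has_frac_p_laplacian C s p u x b \<and> a - b + c x * w x = 0"
        using equation unfolding ul by blast
    qed
  qed
  then show "\<exists>D. ((\<lambda>t. w (x0 + t *\<^sub>R \<nu>)) has_real_derivative D) (at 0) \<and> D < 0"
    using D by (intro exI[of _ "- gw x0 $ e"]) auto
qed

end
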